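(* Let $T$ be a two branch piecewise linear map (a piecewise linear map with $q=2$). Then the Lyapunov spectrum $L$ of $T$ has at most two points of inflection.
   Context: Piecewise linear map: given an integer $q\ge 2$ and pairwise disjoint closed sub-intervals $X_1,\dots,X_q$ of $[0,1]$ with lengths $|X_i|>0$, a piecewise linear map with $q$ branches is a map $T:\bigcup_{i=1}^q X_i\to[0,1]$ whose restriction to each $X_i$ is an affine homeomorphism onto $[0,1]$ (so $|T'|=|X_i|^{-1}$ on $X_i$). Its invariant set is $X=\{x\in[0,1]:T^n(x)\in\bigcup_{i=1}^q X_i\text{ for all }n\ge0\}$, and $T$ is regarded as a dynamical system $T:X\to X$. Lyapunov spectrum: for $x\in X$ let $\lambda(x)=\lim_{n\to\infty}\frac1n\log|(T^n)'(x)|$ whenever this limit exists. The set $A$ of all values taken by $\lambda$ is a closed interval $[\alpha_{\min},\alpha_{\max}]$ (a single point if all $|X_i|$ are equal). The Lyapunov spectrum is $L:A\to\mathbb{R}$, $L(\alpha)=\dim_H\{x\in X:\lambda(x)\text{ exists and equals }\alpha\}$, where $\dim_H$ is Hausdorff dimension. $L$ is real analytic on $(\alpha_{\min},\alpha_{\max})$. A point of inflection of $L$ is a point $\alpha\in(\alpha_{\min},\alpha_{\max})$ with $L''(\alpha)=0$. *)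

theory Defs
  imports "HOL-Analysis.Analysis"
begin

section \<open>Hausdorff dimension\<close>

text \<open>
  \<open>diam_powr s U\<close> is the \<open>s\<close>-th power of the diameter, with the usual conventions for \<open>s = 0\<close>:
  it is 0 on the empty set and 1 on nonempty sets, including singletons
  (whereas \<open>0 powr 0 = 0\<close> in HOL).
\<close>

definition diam_powr :: "real \<Rightarrow> 'a::metric_space set \<Rightarrow> real" where
  "diam_powr s U = (if U = {} then 0 else if s = 0 then 1 else diameter U powr s)"

text \<open>Boundedness is required because \<^const>\<open>diameter\<close> is unspecified on unbounded sets.\<close>

definition hausdorff_premeasure :: "real \<Rightarrow> real \<Rightarrow> 'a::metric_space set \<Rightarrow> ennreal" where
  "hausdorff_premeasure s \<delta> S =
     Inf {(\<Sum>i. ennreal (diam_powr s (U i))) | U :: nat \<Rightarrow> 'a set.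
            S \<subseteq> (\<Union>i. U i) \<and> (\<forall>i. bounded (U i) \<and> diameter (U i) \<le> \<delta>)}"

definition hausdorff_measure :: "real \<Rightarrow> 'a::metric_space set \<Rightarrow> ennreal" where
  "hausdorff_measure s S = (SUP \<delta>\<in>{0<..}. hausdorff_premeasure s \<delta> S)"

definition hausdorff_dim :: "'a::metric_space set \<Rightarrow> ennreal" where
  "hausdorff_dim S = (INF s\<in>{s. 0 \<le> s \<and> hausdorff_measure s S = 0}. ennreal s)"


section \<open>Piecewise linear maps\<close>

text \<open>
  The map is a total function \<open>T\<close> whose values outside \<open>\<Union>i\<in>{1..q}. X i\<close> are irrelevant.
\<close>

definition piecewise_linear_map :: "nat \<Rightarrow> (nat \<Rightarrow> real set) \<Rightarrow> (real \<Rightarrow> real) \<Rightarrow> bool" where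
  "piecewise_linear_map q X T \<longleftrightarrow>
     2 \<le> q \<and>
     (\<forall>i\<in>{1..q}. \<exists>a b. a < b \<and> X i = {a..b} \<and> X i \<subseteq> {0..1}) \<and>
     disjoint_family_on X {1..q} \<and>
     (\<forall>i\<in>{1..q}. (\<exists>c d. \<forall>x\<in>X i. T x = c * x + d) \<and> (\<exists>g. homeomorphism (X i) {0..1} T g))"

text \<open>
  From here on \<open>D\<close> stands for the domain \<open>\<Union>i\<in>{1..q}. X i\<close> of the map \<open>T\<close>;
  \<open>iterate_domain D T n\<close> is the set on which the \<open>n\<close>-th iterate of the partial map is defined.
\<close>

definition iterate_domain :: "real set \<Rightarrow> (real \<Rightarrow> real) \<Rightarrow> nat \<Rightarrow> real set" where
  "iterate_domain D T n = {x\<in>{0..1}. \<forall>k<n. (T ^^ k) x \<in> D}"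

definition invariant_set :: "real set \<Rightarrow> (real \<Rightarrow> real) \<Rightarrow> real set" where
  "invariant_set D T = {x\<in>{0..1}. \<forall>n. (T ^^ n) x \<in> D}"


section \<open>Lyapunov spectrum\<close>

text \<open>
  The derivative is taken within the domain of the iterate, i.e. it is one-sided at the endpoints
  of the intervals making up that domain.
\<close>

definition iterate_deriv :: "real set \<Rightarrow> (real \<Rightarrow> real) \<Rightarrow> nat \<Rightarrow> real \<Rightarrow> real" where
  "iterate_deriv D T n x = vector_derivative (T ^^ n) (at x within iterate_domain D T n)"

definition has_lyapunov_exponent :: "real set \<Rightarrow> (real \<Rightarrow> real) \<Rightarrow> real \<Rightarrow> real \<Rightarrow> bool" where
  "has_lyapunov_exponent D T x \<alpha> \<longleftrightarrow>
     (\<lambda>n. 1 / real n * ln \<bar>iterate_deriv D T n x\<bar>) \<longlonglongrightarrow> \<alpha>"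

definition lyapunov_values :: "real set \<Rightarrow> (real \<Rightarrow> real) \<Rightarrow> real set" where
  "lyapunov_values D T = {\<alpha>. \<exists>x\<in>invariant_set D T. has_lyapunov_exponent D T x \<alpha>}"

definition lyapunov_min :: "real set \<Rightarrow> (real \<Rightarrow> real) \<Rightarrow> real" where
  "lyapunov_min D T = Inf (lyapunov_values D T)"

definition lyapunov_max :: "real set \<Rightarrow> (real \<Rightarrow> real) \<Rightarrow> real" where
  "lyapunov_max D T = Sup (lyapunov_values D T)"

text \<open>Only the values on \<open>lyapunov_values D T\<close> are meaningful.\<close>

definition lyapunov_spectrum :: "real set \<Rightarrow> (real \<Rightarrow> real) \<Rightarrow> real \<Rightarrow> real" where
  "lyapunov_spectrum D T \<alpha> =
     enn2real (hausdorff_dim {x\<in>invariant_set D T. has_lyapunov_exponent D T x \<alpha>})"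

definition inflection_points :: "real set \<Rightarrow> (real \<Rightarrow> real) \<Rightarrow> real set" where
  "inflection_points D T =
     {\<alpha>\<in>{lyapunov_min D T<..<lyapunov_max D T}. deriv (deriv (lyapunov_spectrum D T)) \<alpha> = 0}"

end

theory Submission
  imports Defs "HOL-Probability.Hoeffding"
begin

text \<open>
  Let \<open>l\<^sub>1\<close>, \<open>l\<^sub>2\<close> be the lengths of the two branches and \<open>a = - ln l\<^sub>1\<close>, \<open>b = - ln l\<^sub>2\<close>. The derivative of
  \<open>T\<^sup>n\<close> at \<open>x\<close> is, up to sign, the product of the slopes along the orbit, and every
  Lyapunov exponent lies between \<open>a\<close> and \<open>b\<close>. If \<open>a = b\<close> there is nothing to show. Otherwise \<open>x\<close> has
  exponent \<open>\<alpha>\<close> iff the orbit visits the first branch with asymptotic frequency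
  \<open>p = (\<alpha> - b) / (a - b)\<close>. For \<open>0 < p < 1\<close> the set of these points has Hausdorff dimension
  \<open>H(p) / \<alpha>\<close>, where \<open>H\<close> is the Bernoulli entropy
  (\<open>hausdorff_dim_level_set\<close>), a theorem of Besicovitch--Eggleston type.

  The dimension formula compares, for a cylinder of order \<open>n\<close> around a point of the level set, the
  length of the cylinder with its Bernoulli weight: logarithmically the weight is like
  \<open>exp (- n H(p))\<close> and the length like \<open>exp (- n \<alpha>)\<close>. If \<open>s > H(p) / \<alpha>\<close>, then eventually the weight
  exceeds the \<open>s\<close>-th power of the length; the weights of all words of a given length add up to 1, so
  covering by long cylinders of this kind shows that the measure of any larger dimension vanishes
  (\<open>hausdorff_measure_eq_0\<close>). If \<open>s < H(p) / \<alpha>\<close>, then eventually the weight is below the \<open>s\<close>-th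
  power of the length. By the strong law of large numbers, derived from Hoeffding's inequality,
  almost every Bernoulli sequence codes a point of the level set, and since the two branches are
  separated by a gap, a small set meets only one cylinder of comparable size; the mass
  distribution principle then gives positive \<open>s\<close>-dimensional measure (\<open>hausdorff_measure_pos\<close>).

  The rest is calculus. Put \<open>h(\<alpha>) = H((\<alpha> - b) / (a - b))\<close>, so that \<open>L(\<alpha>) = h(\<alpha>) / \<alpha>\<close> and
  \<open>\<alpha>\<^sup>3 L''(\<alpha>) = G(\<alpha>)\<close> with \<open>G(\<alpha>) = \<alpha>\<^sup>2 h''(\<alpha>) - 2 \<alpha> h'(\<alpha>) + 2 h(\<alpha>)\<close>. In \<open>G'\<close> everything cancels but
  \<open>\<alpha>\<^sup>2 h'''(\<alpha>)\<close>, and \<open>H'''\<close> vanishes only at \<open>p = 1 / 2\<close>. By Rolle's theorem \<open>G\<close> has at most two zeros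
  (\<open>card_inflections_entropy_quotient\<close>).
\<close>

section \<open>At most two inflections of an entropy quotient\<close>

definition bernoulli_entropy :: "real \<Rightarrow> real" where
  "bernoulli_entropy p = - (p * ln p + (1 - p) * ln (1 - p))"

lemma bernoulli_entropy_nonneg:
  assumes "0 < p" "p < 1" shows "0 \<le> bernoulli_entropy p"
proof -
  have "p * ln p \<le> 0" "(1 - p) * ln (1 - p) \<le> 0"
    using assms by (intro mult_nonneg_nonpos; simp)+
  then show ?thesis by (simp add: bernoulli_entropy_def)
qed

lemma card_le_2_if_no_chain:
  fixes S :: "'a::linorder set"
  assumes no: "\<And>x y z. x \<in> S \<Longrightarrow> y \<in> S \<Longrightarrow> z \<in> S \<Longrightarrow> x < y \<Longrightarrow> y < z \<Longrightarrow> False"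
  shows "finite S \<and> card S \<le> 2"
proof (rule ccontr)
  assume "\<not> ?thesis"
  then have "\<exists>F\<subseteq>S. finite F \<and> card F = 3"
    by (metis infinite_arbitrarily_large not_less_eq_eq numeral_3_eq_3 numeral_2_eq_2 obtain_subset_with_card_n)
  then obtain F where F: "F \<subseteq> S" "card F = 3" by blast
  then obtain x y z where "F = {x, y, z}" "x \<noteq> y" "x \<noteq> z" "y \<noteq> z"
    by (auto simp: card_3_iff)
  with F no show False
    by (metis insert_subset neqE)
qed

text \<open>By Rolle's theorem, three zeros of a function separate two distinct zeros of its derivative.\<close>

lemma card_zeros_le_2:
  fixes G G' :: "real \<Rightarrow> real"
  assumes G: "\<And>x. x \<in> {l<..<u} \<Longrightarrow> (G has_real_derivative G' x) (at x)"
    and unique: "\<And>x y. x \<in> {l<..<u} \<Longrightarrow> y \<in> {l<..<u} \<Longrightarrow> G' x = 0 \<Longrightarrow> G' y = 0 \<Longrightarrow> x = y"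
  shows "finite {x \<in> {l<..<u}. G x = 0} \<and> card {x \<in> {l<..<u}. G x = 0} \<le> 2"
proof (rule card_le_2_if_no_chain)
  have rolle: "\<exists>\<xi>. x < \<xi> \<and> \<xi> < y \<and> G' \<xi> = 0"
    if "x \<in> {x \<in> {l<..<u}. G x = 0}" "y \<in> {x \<in> {l<..<u}. G x = 0}" "x < y" for x y
  proof (rule Rolle_deriv[OF \<open>x < y\<close>, of G "\<lambda>\<xi> v. G' \<xi> * v", THEN exE])
    show "G x = G y" using that by simp
    show "continuous_on {x..y} G"
      using that by (intro DERIV_continuous_on[of _ _ G'] has_field_derivative_at_within[OF G]) auto
    show "(G has_derivative (*) (G' \<xi>)) (at \<xi>)" if "x < \<xi>" "\<xi> < y" for \<xi>
      using G[of \<xi>] that \<open>x \<in> _\<close> \<open>y \<in> _\<close> by (auto simp: has_field_derivative_def)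
    fix \<xi> assume "x < \<xi> \<and> \<xi> < y \<and> (*) (G' \<xi>) = (\<lambda>v. 0)"
    then have "x < \<xi> \<and> \<xi> < y \<and> G' \<xi> = 0" by (metis mult.right_neutral)
    then show ?thesis by blast
  qed
  fix x y z assume *: "x \<in> {x \<in> {l<..<u}. G x = 0}" "y \<in> {x \<in> {l<..<u}. G x = 0}"
    "z \<in> {x \<in> {l<..<u}. G x = 0}" "x < y" "y < z"
  obtain \<xi> \<eta> where "x < \<xi>" "\<xi> < y" "G' \<xi> = 0" "y < \<eta>" "\<eta> < z" "G' \<eta> = 0"
    using rolle[OF *(1,2,4)] rolle[OF *(2,3,5)] by blast
  with unique[of \<xi> \<eta>] * show False by auto
qed

lemma deriv_eqI_open:
  fixes f f' g :: "real \<Rightarrow> real"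
  assumes "open S" "x \<in> S" "\<And>y. y \<in> S \<Longrightarrow> (f has_real_derivative f' y) (at y)"
    and "\<And>y. y \<in> S \<Longrightarrow> g y = f y"
  shows "deriv g x = f' x"
proof -
  have "(g has_real_derivative f' x) (at x)"
    by (rule has_field_derivative_transform_within_open[OF assms(3)[OF assms(2)] assms(1,2)])
      (simp add: assms(4))
  then show ?thesis by (rule DERIV_imp_deriv)
qed

lemma second_deriv_divide:
  fixes h h1 h2 L :: "real \<Rightarrow> real"
  assumes S: "open S" "0 \<notin> S" and x: "x \<in> S"
    and h: "\<And>y. y \<in> S \<Longrightarrow> (h has_real_derivative h1 y) (at y)"
    and h1: "\<And>y. y \<in> S \<Longrightarrow> (h1 has_real_derivative h2 y) (at y)"
    and L: "\<And>y. y \<in> S \<Longrightarrow> L y = h y / y"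
  shows "deriv (deriv L) x = (x\<^sup>2 * h2 x - 2 * x * h1 x + 2 * h x) / x ^ 3"
proof -
  have nz: "y \<noteq> 0" if "y \<in> S" for y using that S(2) by auto
  have D1: "((\<lambda>y. h y / y) has_real_derivative (h1 y * y - h y) / y\<^sup>2) (at y)" if "y \<in> S" for y
    using h[OF that] nz[OF that]
    by (auto intro!: derivative_eq_intros simp: power2_eq_square)
  have D2: "((\<lambda>y. (h1 y * y - h y) / y\<^sup>2) has_real_derivative
      (y\<^sup>2 * h2 y - 2 * y * h1 y + 2 * h y) / y ^ 3) (at y)" if "y \<in> S" for y
    using h[OF that] h1[OF that] nz[OF that]
    by (auto intro!: derivative_eq_intros simp: field_simps power2_eq_square power3_eq_cube)
  have "deriv L y = (h1 y * y - h y) / y\<^sup>2" if "y \<in> S" for y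
    by (rule deriv_eqI_open[OF S(1) that D1 L])
  from deriv_eqI_open[OF S(1) x D2 this] show ?thesis .
qed

lemma affine_mem_unit_interval:
  fixes a b \<alpha> :: real
  assumes "\<alpha> \<in> {min a b<..<max a b}"
  shows "(\<alpha> - b) / (a - b) \<in> {0<..<1}"
  using assms by (cases a b rule: linorder_cases) (auto simp: field_simps)

text \<open>
  The numerator \<open>G\<close> of \<open>L''\<close> has the derivative \<open>\<alpha>\<^sup>2 h'''(\<alpha>)\<close>, because the terms with \<open>h'\<close> and \<open>h''\<close>
  cancel. As \<open>h\<close> is the entropy in an affine coordinate \<open>p\<close>, the third derivative is a nonzero
  multiple of \<open>1 / p\<^sup>2 - 1 / (1 - p)\<^sup>2\<close> and vanishes only where \<open>p = 1 / 2\<close>.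
\<close>

lemma card_inflections_entropy_quotient:
  fixes a b :: real and L :: "real \<Rightarrow> real"
  assumes pos: "0 < a" "0 < b"
    and L: "\<And>\<alpha>. \<alpha> \<in> {min a b<..<max a b} \<Longrightarrow> L \<alpha> = bernoulli_entropy ((\<alpha> - b) / (a - b)) / \<alpha>"
  shows "finite {\<alpha> \<in> {min a b<..<max a b}. deriv (deriv L) \<alpha> = 0} \<and>
    card {\<alpha> \<in> {min a b<..<max a b}. deriv (deriv L) \<alpha> = 0} \<le> 2"
proof -
  let ?S = "{min a b<..<max a b}"
  define k where "k = 1 / (a - b)"
  define p where "p = (\<lambda>\<alpha>. (\<alpha> - b) / (a - b))"
  define h where "h = (\<lambda>\<alpha>. bernoulli_entropy (p \<alpha>))"
  define h1 where "h1 = (\<lambda>\<alpha>. k * (ln (1 - p \<alpha>) - ln (p \<alpha>)))"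
  define h2 where "h2 = (\<lambda>\<alpha>. - (k\<^sup>2 * (1 / (1 - p \<alpha>) + 1 / p \<alpha>)))"
  define h3 where "h3 = (\<lambda>\<alpha>. k ^ 3 * (1 / (p \<alpha>)\<^sup>2 - 1 / (1 - p \<alpha>)\<^sup>2))"
  define G where "G = (\<lambda>\<alpha>. \<alpha>\<^sup>2 * h2 \<alpha> - 2 * \<alpha> * h1 \<alpha> + 2 * h \<alpha>)"
  have p01: "0 < p \<alpha>" "p \<alpha> < 1" if "\<alpha> \<in> ?S" for \<alpha>
    using affine_mem_unit_interval[OF that] by (auto simp: p_def)
  have Dp: "(p has_real_derivative k) (at \<alpha>)" for \<alpha>
    unfolding p_def k_def divide_inverse by (auto intro!: derivative_eq_intros)
  have Dh: "(h has_real_derivative h1 \<alpha>) (at \<alpha>)" if "\<alpha> \<in> ?S" for \<alpha>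
  proof -
    have "((\<lambda>x. x * ln x + (1 - x) * ln (1 - x)) has_real_derivative ln x - ln (1 - x)) (at x)"
      if "0 < x" "x < 1" for x :: real
      using that by (auto intro!: derivative_eq_intros)
    from DERIV_minus[OF DERIV_chain2[OF this[OF p01[OF that]] Dp]] show ?thesis
      by (simp add: h_def h1_def bernoulli_entropy_def algebra_simps)
  qed
  have Dh1: "(h1 has_real_derivative h2 \<alpha>) (at \<alpha>)" if "\<alpha> \<in> ?S" for \<alpha>
    unfolding h1_def h2_def using p01[OF that]
    by (auto intro!: derivative_eq_intros Dp simp: field_simps power2_eq_square)
  have Dh2: "(h2 has_real_derivative h3 \<alpha>) (at \<alpha>)" if "\<alpha> \<in> ?S" for \<alpha>
    unfolding h2_def h3_def using p01[OF that]
    by (auto intro!: derivative_eq_intros Dp simp: field_simps power2_eq_square power3_eq_cube)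
  have DG: "(G has_real_derivative \<alpha>\<^sup>2 * h3 \<alpha>) (at \<alpha>)" if "\<alpha> \<in> ?S" for \<alpha>
    unfolding G_def using Dh[OF that] Dh1[OF that] Dh2[OF that]
    by (auto intro!: derivative_eq_intros simp: algebra_simps)
  have nz: "\<alpha> > 0" if "\<alpha> \<in> ?S" for \<alpha> using that pos by auto
  have half: "p \<alpha> = 1 / 2" if "\<alpha> \<in> ?S" "\<alpha>\<^sup>2 * h3 \<alpha> = 0" for \<alpha>
  proof -
    have "k \<noteq> 0" using that(1) by (auto simp: k_def)
    then have "(p \<alpha>)\<^sup>2 = (1 - p \<alpha>)\<^sup>2"
      using that nz[OF that(1)] p01[OF that(1)] by (simp add: h3_def divide_simps split: if_splits)
    then show ?thesis by (simp add: power2_eq_square algebra_simps)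
  qed
  have "finite {\<alpha> \<in> ?S. G \<alpha> = 0} \<and> card {\<alpha> \<in> ?S. G \<alpha> = 0} \<le> 2"
  proof (rule card_zeros_le_2[OF DG])
    fix x y assume "x \<in> ?S" "y \<in> ?S" "x\<^sup>2 * h3 x = 0" "y\<^sup>2 * h3 y = 0"
    then have "p x = p y" "a \<noteq> b" using half[of x] half[of y] by auto
    then show "x = y" by (simp add: p_def)
  qed
  moreover have "deriv (deriv L) \<alpha> = G \<alpha> / \<alpha> ^ 3" if "\<alpha> \<in> ?S" for \<alpha>
    unfolding G_def
  proof (rule second_deriv_divide[OF _ _ that Dh Dh1])
    show "open ?S" by simp
    show "0 \<notin> ?S" using nz by blast
    show "L y = h y / y" if "y \<in> ?S" for y using L[OF that] by (simp add: h_def p_def)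
  qed
  then have "{\<alpha> \<in> ?S. deriv (deriv L) \<alpha> = 0} = {\<alpha> \<in> ?S. G \<alpha> = 0}"
    using nz by force
  ultimately show ?thesis by simp
qed

section \<open>Bernoulli sequences and the frequency of a symbol\<close>

definition prefix_word :: "(nat \<Rightarrow> bool) \<Rightarrow> nat \<Rightarrow> bool list" where
  "prefix_word \<omega> n = map \<omega> [0..<n]"

lemma length_prefix_word [simp]: "length (prefix_word \<omega> n) = n"
  by (simp add: prefix_word_def)

definition bernoulli_process :: "real \<Rightarrow> (nat \<Rightarrow> bool) measure" where
  "bernoulli_process p = PiM UNIV (\<lambda>_. measure_pmf (bernoulli_pmf p))"

definition word_weight :: "real \<Rightarrow> bool list \<Rightarrow> real" where
  "word_weight p w = prod_list (map (\<lambda>i. if i then p else 1 - p) w)"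

definition has_frequency :: "(nat \<Rightarrow> bool) \<Rightarrow> real \<Rightarrow> bool" where
  "has_frequency \<omega> p \<longleftrightarrow> (\<lambda>n. (\<Sum>k<n. of_bool (\<omega> k)) / real n) \<longlonglongrightarrow> p"

lemma space_bernoulli_process [simp]: "space (bernoulli_process p) = UNIV"
  by (simp add: bernoulli_process_def space_PiM)

lemma prob_space_bernoulli_process: "prob_space (bernoulli_process p)"
  unfolding bernoulli_process_def by (intro prob_space_PiM prob_space_measure_pmf)

lemma measurable_coordinate [measurable]:
  "(\<lambda>\<omega>. \<omega> k) \<in> measurable (bernoulli_process p) (count_space UNIV)"
proof -
  have "(\<lambda>\<omega>. \<omega> k) \<in> measurable (bernoulli_process p) (measure_pmf (bernoulli_pmf p))"
    unfolding bernoulli_process_def by measurable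
  then show ?thesis by simp
qed

lemma distr_coordinate:
  "distr (bernoulli_process p) (measure_pmf (bernoulli_pmf p)) (\<lambda>\<omega>. \<omega> k) = measure_pmf (bernoulli_pmf p)"
  unfolding bernoulli_process_def
  by (rule distr_PiM_component) (auto intro: prob_space_measure_pmf)

text \<open>
  Independence of finitely many coordinates says that the projection to them has the product
  distribution, and this is the marginal property of the infinite product.
\<close>

lemma indep_coordinates:
  assumes "finite I"
  shows "prob_space.indep_vars (bernoulli_process p) (\<lambda>_. measure_pmf (bernoulli_pmf p)) (\<lambda>k \<omega>. \<omega> k) I"
proof -
  interpret prob_space "bernoulli_process p" by (rule prob_space_bernoulli_process)
  interpret P: product_prob_space "\<lambda>_. measure_pmf (bernoulli_pmf p)" "UNIV :: nat set"
    by unfold_locales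
  show ?thesis
  proof (cases "I = {}")
    case False
    show ?thesis
    proof (subst indep_vars_iff_distr_eq_PiM'[OF False])
      show "random_variable (measure_pmf (bernoulli_pmf p)) (\<lambda>\<omega>. \<omega> i)" for i
        unfolding bernoulli_process_def by measurable
      show "distr (bernoulli_process p) (\<Pi>\<^sub>M i\<in>I. measure_pmf (bernoulli_pmf p)) (\<lambda>x. \<lambda>i\<in>I. x i) =
        (\<Pi>\<^sub>M i\<in>I. distr (bernoulli_process p) (measure_pmf (bernoulli_pmf p)) (\<lambda>\<omega>. \<omega> i))"
        unfolding distr_coordinate
        using P.distr_PiM_restrict_finite[OF assms] by (simp add: bernoulli_process_def restrict_def)
    qed
  qed (simp add: indep_vars_def2 indep_sets_def)
qed

lemma emeasure_cylinder:
  assumes "0 \<le> p" "p \<le> 1"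
  shows "emeasure (bernoulli_process p) {\<omega>. map \<omega> [0..<length w] = w} = ennreal (word_weight p w)"
proof -
  interpret P: product_prob_space "\<lambda>_. measure_pmf (bernoulli_pmf p)" "UNIV :: nat set"
    by (intro product_prob_spaceI prob_space_measure_pmf)
  have "{\<omega>. map \<omega> [0..<length w] = w} =
      prod_emb UNIV (\<lambda>_. measure_pmf (bernoulli_pmf p)) {..<length w} (\<Pi>\<^sub>E i\<in>{..<length w}. {w ! i})"
  proof (rule set_eqI)
    fix \<omega> :: "nat \<Rightarrow> bool"
    have "\<omega> \<in> {\<omega>. map \<omega> [0..<length w] = w} \<longleftrightarrow> (\<forall>i<length w. \<omega> i = w ! i)"
      unfolding mem_Collect_eq list_eq_iff_nth_eq by simp
    also have "\<dots> \<longleftrightarrow> \<omega> \<in> prod_emb UNIV (\<lambda>_. measure_pmf (bernoulli_pmf p)) {..<length w} (\<Pi>\<^sub>E i\<in>{..<length w}. {w ! i})"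
      unfolding prod_emb_def by (simp add: restrict_PiE_iff Pi_iff Ball_def)
    finally show "\<omega> \<in> {\<omega>. map \<omega> [0..<length w] = w} \<longleftrightarrow>
      \<omega> \<in> prod_emb UNIV (\<lambda>_. measure_pmf (bernoulli_pmf p)) {..<length w} (\<Pi>\<^sub>E i\<in>{..<length w}. {w ! i})" .
  qed
  then have "emeasure (bernoulli_process p) {\<omega>. map \<omega> [0..<length w] = w} =
      emeasure (PiM UNIV (\<lambda>_. measure_pmf (bernoulli_pmf p)))
        (prod_emb UNIV (\<lambda>_. measure_pmf (bernoulli_pmf p)) {..<length w} (\<Pi>\<^sub>E i\<in>{..<length w}. {w ! i}))"
    by (simp only: bernoulli_process_def)
  also have "\<dots> = (\<Prod>i<length w. emeasure (measure_pmf (bernoulli_pmf p)) {w ! i})"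
    by (rule P.emeasure_PiM_emb) simp_all
  also have "\<dots> = (\<Prod>i<length w. ennreal (if w ! i then p else 1 - p))"
    using assms by (intro prod.cong refl) (simp add: emeasure_pmf_single)
  also have "\<dots> = ennreal (\<Prod>i<length w. if w ! i then p else 1 - p)"
    using assms by (intro prod_ennreal) auto
  also have "(\<Prod>i<length w. if w ! i then p else 1 - p) = word_weight p w"
    by (simp add: word_weight_def prod.list_conv_set_nth atLeast0LessThan)
  finally show ?thesis .
qed

lemma prob_frequency_deviation:
  assumes p: "0 \<le> p" "p \<le> 1" and "0 < n" "0 < \<epsilon>"
  shows "measure (bernoulli_process p) {\<omega>. \<epsilon> \<le> \<bar>(\<Sum>k<n. of_bool (\<omega> k)) / real n - p\<bar>}
    \<le> 2 * exp (- 2 * \<epsilon>\<^sup>2) ^ n"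
proof -
  interpret prob_space "bernoulli_process p" by (rule prob_space_bernoulli_process)
  define Y :: "nat \<Rightarrow> (nat \<Rightarrow> bool) \<Rightarrow> real" where "Y = (\<lambda>k \<omega>. of_bool (\<omega> k))"
  have E: "expectation (Y k) = p" for k
  proof -
    have "expectation (Y k) = measure_pmf.expectation (bernoulli_pmf p) (of_bool :: bool \<Rightarrow> real)"
      unfolding Y_def
      by (subst distr_coordinate[symmetric, of p k], rule integral_distr[symmetric]) auto
    then show ?thesis using p by simp
  qed
  interpret indep_interval_bounded_random_variables "bernoulli_process p" "{..<n}" Y "\<lambda>_. 0" "\<lambda>_. 1"
  proof
    show "indep_vars (\<lambda>_. borel) Y {..<n}"
      unfolding Y_def by (rule indep_vars_compose2[OF indep_coordinates]) auto
  qed (auto simp: Y_def)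
  interpret H: Hoeffding_ineq "bernoulli_process p" "{..<n}" Y "\<lambda>_. 0" "\<lambda>_. 1" "real n * p"
    by unfold_locales (simp add: E)
  have "{\<omega>. \<epsilon> \<le> \<bar>(\<Sum>k<n. of_bool (\<omega> k)) / real n - p\<bar>} =
      {\<omega> \<in> space (bernoulli_process p). real n * \<epsilon> \<le> \<bar>(\<Sum>k<n. Y k \<omega>) - real n * p\<bar>}"
  proof (intro Collect_eqI)
    fix \<omega> :: "nat \<Rightarrow> bool"
    have "\<bar>(\<Sum>k<n. of_bool (\<omega> k)) / real n - p\<bar> = \<bar>(\<Sum>k<n. Y k \<omega>) - real n * p\<bar> / real n"
      using \<open>0 < n\<close> by (simp add: Y_def field_simps abs_divide flip: abs_mult)
    then show "\<epsilon> \<le> \<bar>(\<Sum>k<n. of_bool (\<omega> k)) / real n - p\<bar> \<longleftrightarrow>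
        \<omega> \<in> space (bernoulli_process p) \<and> real n * \<epsilon> \<le> \<bar>(\<Sum>k<n. Y k \<omega>) - real n * p\<bar>"
      using \<open>0 < n\<close> by (simp add: field_simps)
  qed
  also have "prob \<dots> \<le> 2 * exp (- 2 * (real n * \<epsilon>)\<^sup>2 / (\<Sum>i<n. (1 - 0)\<^sup>2))"
    by (rule H.Hoeffding_ineq_abs_ge) (use assms in auto)
  also have "- 2 * (real n * \<epsilon>)\<^sup>2 / (\<Sum>i<n. (1 - 0)\<^sup>2) = real n * (- 2 * \<epsilon>\<^sup>2)"
    using \<open>0 < n\<close> by (simp add: power2_eq_square)
  finally show ?thesis by (simp only: exp_of_nat_mult)
qed

text \<open>
  The strong law of large numbers for coin tossing: Hoeffding's bound on a deviation by \<open>\<epsilon>\<close> is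
  geometric in \<open>n\<close>, hence summable, and the Borel--Cantelli lemma applies to each \<open>\<epsilon> = 1 / (m + 1)\<close>.
\<close>

lemma AE_has_frequency:
  assumes p: "0 \<le> p" "p \<le> 1"
  shows "AE \<omega> in bernoulli_process p. has_frequency \<omega> p"
proof -
  interpret prob_space "bernoulli_process p" by (rule prob_space_bernoulli_process)
  define freq :: "nat \<Rightarrow> (nat \<Rightarrow> bool) \<Rightarrow> real" where "freq = (\<lambda>n \<omega>. (\<Sum>k<n. of_bool (\<omega> k)) / real n)"
  have meas: "{\<omega>. \<epsilon> \<le> \<bar>freq n \<omega> - p\<bar>} \<in> sets (bernoulli_process p)" for n \<epsilon>
  proof -
    have "{\<omega> \<in> space (bernoulli_process p). \<epsilon> \<le> \<bar>freq n \<omega> - p\<bar>} \<in> sets (bernoulli_process p)"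
      unfolding freq_def by measurable
    then show ?thesis by simp
  qed
  have "AE \<omega> in bernoulli_process p. \<forall>\<^sub>F n in sequentially. \<omega> \<in> space (bernoulli_process p) - {\<omega>. \<epsilon> \<le> \<bar>freq n \<omega> - p\<bar>}"
    if "\<epsilon> > 0" for \<epsilon>
  proof (rule borel_cantelli_AE1[OF meas])
    have "summable (\<lambda>n. 2 * exp (- 2 * \<epsilon>\<^sup>2) ^ n)"
      using that by (intro summable_mult summable_geometric) auto
    then show "summable (\<lambda>n. prob {\<omega>. \<epsilon> \<le> \<bar>freq n \<omega> - p\<bar>})"
      by (rule summable_comparison_test'[where N = 1])
        (use prob_frequency_deviation[OF p _ that] in \<open>auto simp: freq_def\<close>)
  qed (simp add: emeasure_eq_measure)
  from this[of "inverse (real (Suc m))" for m]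
  have "AE \<omega> in bernoulli_process p. \<forall>\<^sub>F n in sequentially. \<bar>freq n \<omega> - p\<bar> < inverse (real (Suc m))" for m
    by (simp add: not_le)
  then have "AE \<omega> in bernoulli_process p. \<forall>m. \<forall>\<^sub>F n in sequentially. \<bar>freq n \<omega> - p\<bar> < inverse (real (Suc m))"
    by (simp add: AE_all_countable)
  then show ?thesis
  proof (rule AE_mp, intro AE_I2 impI)
    fix \<omega> assume *: "\<forall>m. \<forall>\<^sub>F n in sequentially. \<bar>freq n \<omega> - p\<bar> < inverse (real (Suc m))"
    show "has_frequency \<omega> p"
      unfolding has_frequency_def
    proof (rule tendstoI)
      fix e :: real assume "e > 0"
      then obtain m where m: "inverse (real (Suc m)) < e" using reals_Archimedean by blast
      from * have "\<forall>\<^sub>F n in sequentially. \<bar>freq n \<omega> - p\<bar> < inverse (real (Suc m))" by blast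
      then show "\<forall>\<^sub>F n in sequentially. dist ((\<Sum>k<n. of_bool (\<omega> k)) / real n) p < e"
        by eventually_elim (use m in \<open>auto simp: freq_def dist_real_def\<close>)
    qed
  qed
qed

lemma sum_over_symbols:
  fixes F :: "bool \<Rightarrow> real"
  shows "(\<Sum>k<n. F (\<omega> k)) = real n * F False + (\<Sum>k<n. of_bool (\<omega> k)) * (F True - F False)"
proof -
  have "(\<Sum>k<n. F (\<omega> k)) = (\<Sum>k<n. F False + of_bool (\<omega> k) * (F True - F False))"
    by (intro sum.cong refl) (auto simp: of_bool_def)
  then show ?thesis by (simp add: sum.distrib sum_distrib_right)
qed

text \<open>
  On a two-letter alphabet, averages of an arbitrary function of the letters are affine in the
  frequency of one letter. So they converge whenever the frequency does, and conversely if the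
  function separates the letters.
\<close>

lemma average_tendsto:
  fixes F :: "bool \<Rightarrow> real"
  assumes "has_frequency \<omega> p"
  shows "(\<lambda>n. (\<Sum>k<n. F (\<omega> k)) / real n) \<longlonglongrightarrow> p * F True + (1 - p) * F False"
proof (rule Lim_transform_eventually)
  define N :: "nat \<Rightarrow> real" where "N = (\<lambda>n. \<Sum>k<n. of_bool (\<omega> k))"
  show "(\<lambda>n. N n / real n * F True + (1 - N n / real n) * F False) \<longlonglongrightarrow> p * F True + (1 - p) * F False"
    using assms unfolding has_frequency_def N_def by (intro tendsto_intros)
  show "\<forall>\<^sub>F n in sequentially. N n / real n * F True + (1 - N n / real n) * F False
      = (\<Sum>k<n. F (\<omega> k)) / real n"
    using eventually_gt_at_top[of 0]
  proof eventually_elim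
    case (elim n)
    have "(\<Sum>k<n. F (\<omega> k)) = real n * F False + N n * (F True - F False)"
      unfolding N_def by (rule sum_over_symbols)
    with elim show ?case by (simp add: field_simps)
  qed
qed

lemma has_frequency_of_average:
  fixes F :: "bool \<Rightarrow> real"
  assumes lim: "(\<lambda>n. (\<Sum>k<n. F (\<omega> k)) / real n) \<longlonglongrightarrow> \<alpha>" and ne: "F True \<noteq> F False"
  shows "has_frequency \<omega> ((\<alpha> - F False) / (F True - F False))"
  unfolding has_frequency_def
proof (rule Lim_transform_eventually)
  define N :: "nat \<Rightarrow> real" where "N = (\<lambda>n. \<Sum>k<n. of_bool (\<omega> k))"
  show "(\<lambda>n. ((\<Sum>k<n. F (\<omega> k)) / real n - F False) / (F True - F False))
      \<longlonglongrightarrow> (\<alpha> - F False) / (F True - F False)"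
    using assms by (intro tendsto_intros) auto
  show "\<forall>\<^sub>F n in sequentially. ((\<Sum>k<n. F (\<omega> k)) / real n - F False) / (F True - F False)
      = (\<Sum>k<n. of_bool (\<omega> k)) / real n"
    using eventually_gt_at_top[of 0]
  proof eventually_elim
    case (elim n)
    have "(\<Sum>k<n. F (\<omega> k)) = real n * F False + N n * (F True - F False)"
      unfolding N_def by (rule sum_over_symbols)
    then have "((\<Sum>k<n. F (\<omega> k)) / real n - F False) / (F True - F False) = N n / real n"
      using elim ne by (simp add: divide_simps)
    then show ?case by (simp only: N_def)
  qed
qed

lemma word_weight_Nil [simp]: "word_weight p [] = 1"
  and word_weight_Cons [simp]: "word_weight p (i # w) = (if i then p else 1 - p) * word_weight p w"
  by (simp_all add: word_weight_def)

lemma word_weight_pos: "0 < p \<Longrightarrow> p < 1 \<Longrightarrow> 0 < word_weight p w"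
  by (induction w) auto

lemma finite_words: "finite {w :: bool list. length w = n}"
  using finite_lists_length_eq[of "UNIV :: bool set" n] by simp

lemma sum_word_weight: "(\<Sum>w | length w = n. word_weight p w) = 1"
proof (induction n)
  case (Suc n)
  let ?W = "{w :: bool list. length w = n}"
  have W: "{w :: bool list. length w = Suc n} = (#) True ` ?W \<union> (#) False ` ?W"
    by (auto simp: length_Suc_conv image_iff)
  have "(\<Sum>w | length w = Suc n. word_weight p w)
      = (\<Sum>w\<in>(#) True ` ?W. word_weight p w) + (\<Sum>w\<in>(#) False ` ?W. word_weight p w)"
    unfolding W by (rule sum.union_disjoint) (auto simp: finite_words)
  also have "\<dots> = p * (\<Sum>w\<in>?W. word_weight p w) + (1 - p) * (\<Sum>w\<in>?W. word_weight p w)"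
    by (simp add: sum.reindex sum_distrib_left)
  finally show ?case using Suc by simp
qed simp

lemma ln_word_weight_prefix:
  assumes "0 < p" "p < 1"
  shows "ln (word_weight p (prefix_word \<omega> n)) = (\<Sum>k<n. ln (if \<omega> k then p else 1 - p))"
proof -
  have "word_weight p (prefix_word \<omega> n) = (\<Prod>k<n. if \<omega> k then p else 1 - p)"
    by (simp add: word_weight_def prefix_word_def prod.list_conv_set_nth atLeast0LessThan)
  then show ?thesis using assms by (simp only:) (rule ln_prod; auto)
qed

lemma measurable_prefix_word [measurable]:
  "(\<lambda>\<omega>. prefix_word \<omega> n) \<in> measurable (bernoulli_process p) (count_space UNIV)"
proof -
  have "(\<lambda>\<omega>. prefix_word \<omega> n) -` {w} \<inter> space (bernoulli_process p) \<in> sets (bernoulli_process p)" for w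
  proof -
    have "(\<lambda>\<omega>. prefix_word \<omega> n) -` {w} \<inter> space (bernoulli_process p) =
        {\<omega> \<in> space (bernoulli_process p). length w = n \<and> (\<forall>i\<in>{..<n}. \<omega> i = w ! i)}"
      unfolding prefix_word_def by (auto simp: map_eq_conv intro!: nth_equalityI)
    also have "\<dots> \<in> sets (bernoulli_process p)" by measurable
    finally show ?thesis .
  qed
  then show ?thesis by (subst measurable_count_space_eq_countable) auto
qed

lemma emeasure_prefix:
  assumes "0 \<le> p" "p \<le> 1"
  shows "emeasure (bernoulli_process p) {\<eta>. prefix_word \<eta> n = prefix_word \<omega> n} =
    ennreal (word_weight p (prefix_word \<omega> n))"
  using emeasure_cylinder[OF assms, of "prefix_word \<omega> n"] by (simp add: prefix_word_def)

section \<open>Hausdorff measure via countable covers\<close>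

lemma hausdorff_measure_eq_0I:
  assumes "\<And>\<delta> \<epsilon>. 0 < \<delta> \<Longrightarrow> 0 < \<epsilon> \<Longrightarrow> hausdorff_premeasure s \<delta> S \<le> ennreal \<epsilon>"
  shows "hausdorff_measure s S = 0"
proof -
  have "hausdorff_premeasure s \<delta> S = 0" if "0 < \<delta>" for \<delta>
    using ennreal_le_epsilon[of 0 "hausdorff_premeasure s \<delta> S"] assms[OF that] by simp
  then have "hausdorff_measure s S \<le> 0"
    unfolding hausdorff_measure_def by (intro SUP_least) simp
  then show ?thesis by simp
qed

lemma diam_powr_nonneg: "0 \<le> diam_powr s U"
  by (simp add: diam_powr_def)

text \<open>
  Covers in the definition of the premeasure are sequences. This form allows covers indexed by a
  set of words, with total cost controlled through finite subfamilies; indices that code no member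
  of \<open>W\<close> get the empty set, whose cost is 0 for every exponent.
\<close>

lemma hausdorff_premeasure_le_countable_cover:
  fixes C :: "'b::countable \<Rightarrow> 'a::metric_space set"
  assumes cover: "S \<subseteq> (\<Union>w\<in>W. C w)" and "0 \<le> \<delta>"
    and small: "\<And>w. w \<in> W \<Longrightarrow> bounded (C w) \<and> diameter (C w) \<le> \<delta>"
    and sums: "\<And>F. finite F \<Longrightarrow> F \<subseteq> W \<Longrightarrow> (\<Sum>w\<in>F. diam_powr s (C w)) \<le> \<epsilon>"
  shows "hausdorff_premeasure s \<delta> S \<le> ennreal \<epsilon>"
proof -
  define U where "U = (\<lambda>i. if i \<in> to_nat ` W then C (from_nat i) else {})"
  have U: "U (to_nat w) = C w" if "w \<in> W" for w using that by (simp add: U_def)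
  have U0: "U i = {}" if "i \<notin> to_nat ` W" for i using that by (simp add: U_def)
  have "hausdorff_premeasure s \<delta> S \<le> (\<Sum>i. ennreal (diam_powr s (U i)))"
    unfolding hausdorff_premeasure_def
  proof (rule Inf_lower, intro CollectI exI[of _ U] conjI refl allI)
    show "S \<subseteq> (\<Union>i. U i)" using cover U by fastforce
    show "bounded (U i)" "diameter (U i) \<le> \<delta>" for i
      using small \<open>0 \<le> \<delta>\<close> by (cases "i \<in> to_nat ` W"; auto simp: U U0)+
  qed
  also have "\<dots> \<le> ennreal \<epsilon>"
  proof (rule suminf_le_const[OF summableI])
    fix N
    define F where "F = {w \<in> W. to_nat w < N}"
    have fin: "finite F"
      by (rule inj_on_finite[of to_nat _ "{..<N}"]) (auto simp: F_def)
    have "(\<Sum>i<N. diam_powr s (U i)) = (\<Sum>i\<in>to_nat ` F. diam_powr s (U i))"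
      by (rule sum.mono_neutral_right) (auto simp: F_def diam_powr_def intro!: U0)
    also have "\<dots> = (\<Sum>w\<in>F. diam_powr s (C w))"
      by (subst sum.reindex) (auto simp: F_def U inj_on_def intro!: sum.cong)
    also have "\<dots> \<le> \<epsilon>" using fin by (rule sums) (auto simp: F_def)
    finally show "(\<Sum>i<N. ennreal (diam_powr s (U i))) \<le> ennreal \<epsilon>"
      by (simp add: sum_ennreal diam_powr_nonneg ennreal_leI)
  qed
  finally show ?thesis .
qed

section \<open>Symbolic coding of a two-branch map\<close>

text \<open>The branches are indexed by truth values, so that itineraries are coin-tossing sequences.\<close>

locale two_branch_map =
  fixes A B c d :: "bool \<Rightarrow> real" and T :: "real \<Rightarrow> real"
  assumes A_less_B: "A i < B i"
    and A_nonneg: "0 \<le> A i" and B_le_1: "B i \<le> 1"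
    and disjoint: "{A True..B True} \<inter> {A False..B False} = {}"
    and T_affine: "x \<in> {A i..B i} \<Longrightarrow> T x = c i * x + d i"
    and T_onto: "T ` {A i..B i} = {0..1}"
begin

abbreviation branch :: "bool \<Rightarrow> real set" where "branch i \<equiv> {A i..B i}"

abbreviation dom :: "real set" where "dom \<equiv> branch True \<union> branch False"

definition len :: "bool \<Rightarrow> real" where "len i = B i - A i"

definition cyl_len :: "bool list \<Rightarrow> real" where "cyl_len w = prod_list (map len w)"

text \<open>
  The distance between the two branches: one of the two differences is negative, and the other one
  is the distance.
\<close>

definition gap :: real where "gap = max (A False - B True) (A True - B False)"

lemma cyl_len_Nil [simp]: "cyl_len [] = 1" and cyl_len_Cons [simp]: "cyl_len (i # w) = len i * cyl_len w"
  by (simp_all add: cyl_len_def)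

lemma len_pos: "0 < len i"
  using A_less_B by (simp add: len_def)

lemma branches_ordered: "B True < A False \<or> B False < A True"
proof (rule ccontr)
  assume "\<not> ?thesis"
  then have "max (A True) (A False) \<in> branch True \<inter> branch False"
    using A_less_B[of True] A_less_B[of False] by auto
  with disjoint show False by blast
qed

lemma gap_pos: "0 < gap"
  using branches_ordered by (auto simp: gap_def)

lemma gap_le:
  assumes "x \<in> branch i" "y \<in> branch j" "i \<noteq> j"
  shows "gap \<le> \<bar>x - y\<bar>"
  using assms branches_ordered A_less_B[of True] A_less_B[of False]
  by (cases i; cases j) (auto simp: gap_def max_def)

lemma len_less_1: "len i < 1"
  using branches_ordered A_less_B[of "\<not> i"] A_nonneg[of "\<not> i"] B_le_1[of "\<not> i"] A_nonneg[of i] B_le_1[of i]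
  by (cases i) (auto simp: len_def)

text \<open>The logarithm of the expansion factor on a branch.\<close>

definition rate :: "bool \<Rightarrow> real" where "rate i = - ln (len i)"

lemma rate_pos: "0 < rate i"
  using len_pos[of i] len_less_1[of i] by (simp add: rate_def)

lemma cyl_len_pos: "0 < cyl_len w"
  by (induction w) (simp_all add: len_pos)

lemma cyl_len_le_butlast: "cyl_len w \<le> cyl_len (butlast w)"
proof (induction w)
  case (Cons i w)
  then show ?case using len_pos[of i] len_less_1[of i] by (auto simp: mult_le_cancel_left)
qed simp

lemma cyl_len_le_1: "cyl_len w \<le> 1"
proof (induction w)
  case (Cons i w)
  then show ?case
    using mult_mono[of "len i" 1 "cyl_len w" 1] len_less_1[of i] len_pos[of i] cyl_len_pos[of w] by simp
qed simp

lemma affine_image: "(\<lambda>x. c i * x + d i) ` {A i..B i} = {0..1}"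
  unfolding T_onto[of i, symmetric] by (rule image_cong) (simp_all add: T_affine)

lemma abs_slope: "\<bar>c i\<bar> = 1 / len i"
proof -
  have "(if 0 \<le> c i then {c i * A i + d i..c i * B i + d i} else {c i * B i + d i..c i * A i + d i}) = {0..1}"
    using affine_image[of i] A_less_B[of i] unfolding image_affinity_atLeastAtMost by simp
  then have "\<bar>c i\<bar> * len i = 1"
    by (auto simp: len_def abs_if algebra_simps split: if_splits)
  then show ?thesis using len_pos[of i] by (simp add: field_simps)
qed

lemma mem_branch_iff: "x \<in> branch i \<longleftrightarrow> c i * x + d i \<in> {0..1}"
proof
  have im: "(\<lambda>x. c i * x + d i) ` {A i..B i} = {0..1}"
    by (rule affine_image)
  then show "x \<in> branch i \<Longrightarrow> c i * x + d i \<in> {0..1}" by blast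
  assume "c i * x + d i \<in> {0..1}"
  then have "c i * x + d i \<in> (\<lambda>x. c i * x + d i) ` branch i" by (simp only: im)
  then obtain y where y: "y \<in> branch i" "c i * x + d i = c i * y + d i" by (elim imageE)
  moreover have "c i \<noteq> 0" using abs_slope[of i] len_pos[of i] by auto
  ultimately show "x \<in> branch i" by simp
qed

text \<open>The points whose itinerary starts with the given word.\<close>

primrec cyl :: "bool list \<Rightarrow> real set" where
  "cyl [] = {0..1}"
| "cyl (i # w) = {x \<in> branch i. T x \<in> cyl w}"

lemma cyl_subset: "cyl w \<subseteq> {0..1}"
proof (cases w)
  case (Cons i v)
  then show ?thesis using A_nonneg[of i] B_le_1[of i] by auto
qed simp

text \<open>
  Prepending a letter pulls an interval in \<open>{0..1}\<close> back along an affine bijection from a branch to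
  \<open>{0..1}\<close>, which scales lengths by the length of the branch.
\<close>

lemma cyl_affine:
  "\<exists>u s t. cyl w = {u..u + cyl_len w} \<and> \<bar>s\<bar> = 1 / cyl_len w \<and> (\<forall>x\<in>cyl w. (T ^^ length w) x = s * x + t)"
proof (induction w)
  case Nil
  show ?case by (rule exI[of _ 0], rule exI[of _ 1], rule exI[of _ 0]) simp
next
  case (Cons i w)
  then obtain u s t where u: "cyl w = {u..u + cyl_len w}" and s: "\<bar>s\<bar> = 1 / cyl_len w"
    and t: "\<And>x. x \<in> cyl w \<Longrightarrow> (T ^^ length w) x = s * x + t" by blast
  have eq: "x \<in> cyl (i # w) \<longleftrightarrow> u \<le> c i * x + d i \<and> c i * x + d i \<le> u + cyl_len w" for x
    using mem_branch_iff[of x i] cyl_subset[of w] T_affine[of x i] u by auto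
  have "\<exists>v. cyl (i # w) = {v..v + cyl_len (i # w)}"
  proof (cases "c i > 0")
    case True
    then have c: "c i * x = x / len i" for x using abs_slope[of i] by simp
    then have "cyl (i # w) = {(u - d i) * len i..(u - d i) * len i + cyl_len (i # w)}"
      using len_pos[of i] unfolding set_eq_iff eq c by (auto simp: field_simps)
    then show ?thesis by blast
  next
    case False
    then have "c i = - (1 / len i)" using abs_slope[of i] by linarith
    then have c: "c i * x = - (x / len i)" for x by simp
    then have "cyl (i # w) = {(d i - u - cyl_len w) * len i..(d i - u - cyl_len w) * len i + cyl_len (i # w)}"
      using len_pos[of i] unfolding set_eq_iff eq c by (auto simp: field_simps)
    then show ?thesis by blast
  qed
  moreover have "\<bar>s * c i\<bar> = 1 / cyl_len (i # w)"
    by (simp add: abs_mult s abs_slope)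
  moreover have "(T ^^ length (i # w)) x = (s * c i) * x + (s * d i + t)" if "x \<in> cyl (i # w)" for x
    using that t[of "T x"] T_affine[of x i] by (auto simp: funpow_swap1 algebra_simps)
  ultimately show ?case by blast
qed

lemma mem_cyl_iff: "x \<in> cyl w \<longleftrightarrow> x \<in> {0..1} \<and> (\<forall>k<length w. (T ^^ k) x \<in> branch (w ! k))"
proof (induction w arbitrary: x)
  case (Cons i w)
  have "x \<in> branch i \<Longrightarrow> x \<in> {0..1} \<and> T x \<in> {0..1}"
    using T_onto[of i] A_nonneg[of i] B_le_1[of i] by auto
  with Cons show ?case
    by (auto simp: All_less_Suc2 funpow_swap1)
qed simp

lemma diameter_cyl: "diameter (cyl w) = cyl_len w"
  using cyl_affine[of w] cyl_len_pos[of w] by auto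

definition itinerary :: "real \<Rightarrow> nat \<Rightarrow> bool" where
  "itinerary x k \<longleftrightarrow> (T ^^ k) x \<in> branch True"

lemma cyl_determines_word:
  assumes "x \<in> cyl w" shows "w = prefix_word (itinerary x) (length w)"
proof (rule nth_equalityI)
  fix k assume "k < length w"
  then have "(T ^^ k) x \<in> branch (w ! k)" using assms by (simp add: mem_cyl_iff)
  then show "w ! k = prefix_word (itinerary x) (length w) ! k"
    using \<open>k < length w\<close> disjoint by (cases "w ! k") (auto simp: prefix_word_def itinerary_def)
qed simp

lemma branch_subset_dom: "branch i \<subseteq> dom"
  by (cases i) auto

lemma mem_dom_iff: "y \<in> dom \<longleftrightarrow> y \<in> branch (y \<in> branch True)"
  by (cases "y \<in> branch True") auto

lemma iterate_domain_iff: "x \<in> iterate_domain dom T n \<longleftrightarrow> x \<in> cyl (prefix_word (itinerary x) n)"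
  unfolding iterate_domain_def mem_cyl_iff mem_dom_iff
  by (simp add: prefix_word_def itinerary_def)

lemma cyl_subset_iterate_domain: "cyl w \<subseteq> iterate_domain dom T (length w)"
  using branch_subset_dom unfolding iterate_domain_def mem_cyl_iff subset_iff mem_Collect_eq by blast

lemma invariant_set_iff: "x \<in> invariant_set dom T \<longleftrightarrow> (\<forall>n. x \<in> cyl (prefix_word (itinerary x) n))"
  unfolding invariant_set_def iterate_domain_iff[symmetric] iterate_domain_def by auto

text \<open>
  If the words differ, let \<open>k\<close> be the first position where they do. The iterate \<open>T\<^sup>k\<close> expands distances
  on the common cylinder of order \<open>k\<close> by the reciprocal of its length and moves the two points into
  different branches, at least a gap apart. This common cylinder is shortest if only the last
  letters differ, and then its word is \<open>butlast w\<close>.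
\<close>

lemma cyl_close_imp_eq:
  assumes "length v = length w" "x \<in> cyl w" "y \<in> cyl v" "\<bar>x - y\<bar> < gap * cyl_len (butlast w)"
  shows "v = w"
  using assms
proof (induction w arbitrary: x y v)
  case (Cons i w)
  then obtain j v' where v: "v = j # v'" "length v' = length w" by (cases v) auto
  have xy: "x \<in> branch i" "y \<in> branch j" "T x \<in> cyl w" "T y \<in> cyl v'" using Cons.prems v by auto
  have "gap * cyl_len (butlast (i # w)) \<le> gap" using cyl_len_le_1 gap_pos by simp
  then have "\<bar>x - y\<bar> < gap" using Cons.prems(4) by linarith
  then have ij: "i = j" using gap_le[OF xy(1,2)] by fastforce
  show ?case
  proof (cases "w = []")
    case True
    then show ?thesis using v ij by simp
  next
    case False
    have "T x - T y = c i * (x - y)" using T_affine[OF xy(1)] T_affine[OF xy(2)] ij by (simp add: algebra_simps)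
    then have "\<bar>T x - T y\<bar> = \<bar>x - y\<bar> / len i" by (simp add: abs_mult abs_slope)
    also have "\<dots> < gap * cyl_len (butlast w)" using Cons.prems(4) False len_pos[of i] by (simp add: field_simps)
    finally show ?thesis using Cons.IH[OF v(2) xy(3,4)] v ij by simp
  qed
qed simp

text \<open>
  Points of the domain of \<open>T\<^sup>n\<close> that are close to \<open>x\<close> lie in the cylinder of order \<open>n\<close> around \<open>x\<close>, on
  which \<open>T\<^sup>n\<close> is affine. The cylinder is a nondegenerate interval, so the derivative within the domain
  is unique.
\<close>

lemma abs_iterate_deriv:
  assumes "x \<in> invariant_set dom T"
  shows "\<bar>iterate_deriv dom T n x\<bar> = 1 / cyl_len (prefix_word (itinerary x) n)"
proof -
  define w where "w = prefix_word (itinerary x) n"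
  have len_w: "length w = n" by (simp add: w_def)
  have x: "x \<in> cyl w" using assms by (simp add: invariant_set_iff w_def)
  obtain u s t where u: "cyl w = {u..u + cyl_len w}" and s: "\<bar>s\<bar> = 1 / cyl_len w"
    and t: "\<And>y. y \<in> cyl w \<Longrightarrow> (T ^^ n) y = s * y + t"
    using cyl_affine[of w] unfolding len_w by blast
  let ?S = "iterate_domain dom T n"
  have sub: "cyl w \<subseteq> ?S"
    using cyl_subset_iterate_domain[of w] by (simp add: len_w)
  have loc: "y \<in> cyl w" if "y \<in> ?S" "dist y x < gap * cyl_len w" for y
  proof -
    have y: "y \<in> cyl (prefix_word (itinerary y) n)" using that(1) by (simp add: iterate_domain_iff)
    have "gap * cyl_len w \<le> gap * cyl_len (butlast w)" using gap_pos cyl_len_le_butlast by simp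
    then have "\<bar>x - y\<bar> < gap * cyl_len (butlast w)" using that(2) by (simp add: dist_real_def abs_minus_commute)
    from cyl_close_imp_eq[OF _ x y this] have "prefix_word (itinerary y) n = w" by (simp add: len_w)
    with y show ?thesis by simp
  qed
  have "((\<lambda>y. s * y + t) has_vector_derivative s) (at x within ?S)"
    by (auto intro!: derivative_eq_intros simp: has_real_derivative_iff_has_vector_derivative[symmetric])
  then have "((T ^^ n) has_vector_derivative s) (at x within ?S)"
  proof (rule has_vector_derivative_transform_within)
    show "0 < gap * cyl_len w" using gap_pos cyl_len_pos by simp
    show "x \<in> ?S" using x sub by blast
    show "s * y + t = (T ^^ n) y" if "y \<in> ?S" "dist y x < gap * cyl_len w" for y
      using t[OF loc[OF that]] by simp
  qed
  moreover have "at x within ?S \<noteq> bot"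
  proof -
    have "at x within cyl w \<noteq> bot"
      using connected_imp_perfect[of "cyl w" x] x cyl_len_pos[of w] unfolding u
      by (auto simp: trivial_limit_within)
    then show ?thesis using at_le[OF sub] by (metis bot.extremum_uniqueI)
  qed
  ultimately have "iterate_deriv dom T n x = s"
    unfolding iterate_deriv_def by (rule vector_derivative_within[rotated])
  then show ?thesis using s by (simp add: w_def)
qed

lemma cyl_len_prefix: "cyl_len (prefix_word \<omega> n) = (\<Prod>k<n. len (\<omega> k))"
  by (simp add: cyl_len_def prefix_word_def prod.list_conv_set_nth atLeast0LessThan)

lemma ln_cyl_len_prefix: "ln (cyl_len (prefix_word \<omega> n)) = (\<Sum>k<n. ln (len (\<omega> k)))"
  unfolding cyl_len_prefix by (rule ln_prod) (simp_all add: less_imp_neq[OF len_pos, symmetric])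

lemma has_lyapunov_exponent_iff:
  assumes "x \<in> invariant_set dom T"
  shows "has_lyapunov_exponent dom T x \<alpha> \<longleftrightarrow>
    (\<lambda>n. (\<Sum>k<n. rate (itinerary x k)) / real n) \<longlonglongrightarrow> \<alpha>"
  unfolding has_lyapunov_exponent_def abs_iterate_deriv[OF assms]
  by (simp add: rate_def divide_inverse ln_inverse ln_cyl_len_prefix sum_negf mult.commute)

text \<open>The cylinders along an itinerary are nested nonempty compact intervals.\<close>

lemma exists_point_with_itinerary: "\<exists>x\<in>invariant_set dom T. itinerary x = \<omega>"
proof -
  have "(\<Inter>n. cyl (prefix_word \<omega> n)) \<noteq> {}"
  proof (rule compact_nest)
    fix n
    obtain u where u: "cyl (prefix_word \<omega> n) = {u..u + cyl_len (prefix_word \<omega> n)}" using cyl_affine by blast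
    show "compact (cyl (prefix_word \<omega> n))" by (simp add: u)
    show "cyl (prefix_word \<omega> n) \<noteq> {}" using cyl_len_pos[of "prefix_word \<omega> n"] by (simp add: u)
  next
    fix m n :: nat assume "m \<le> n"
    then show "cyl (prefix_word \<omega> n) \<subseteq> cyl (prefix_word \<omega> m)"
      by (auto simp: mem_cyl_iff prefix_word_def)
  qed
  then obtain x where x: "\<And>n. x \<in> cyl (prefix_word \<omega> n)" by blast
  have "itinerary x = \<omega>"
  proof
    fix k
    have "prefix_word \<omega> (Suc k) = prefix_word (itinerary x) (Suc k)"
      using cyl_determines_word[OF x[of "Suc k"]] by simp
    then show "itinerary x k = \<omega> k" by (simp add: prefix_word_def)
  qed
  moreover from this x have "x \<in> invariant_set dom T" by (simp add: invariant_set_iff)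
  ultimately show ?thesis by blast
qed

section \<open>Upper bound: covers by heavy cylinders\<close>

lemma sum_power_tail_le:
  fixes \<theta> :: real
  assumes "0 \<le> \<theta>" "\<theta> < 1"
  shows "(\<Sum>n=m..<M. \<theta> ^ n) \<le> \<theta> ^ m / (1 - \<theta>)"
proof (cases "m \<le> M")
  case True
  then have "(1 - \<theta>) * (\<Sum>n=m..<M. \<theta> ^ n) = \<theta> ^ m - \<theta> ^ M"
  proof (induction rule: dec_induct)
    case (step n)
    have "(1 - \<theta>) * (\<Sum>k=m..<Suc n. \<theta> ^ k) = (1 - \<theta>) * (\<Sum>k=m..<n. \<theta> ^ k) + (1 - \<theta>) * \<theta> ^ n"
      using step.hyps by (simp add: distrib_left)
    then show ?case unfolding step.IH by (simp add: algebra_simps)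
  qed simp
  then have "(1 - \<theta>) * (\<Sum>n=m..<M. \<theta> ^ n) \<le> \<theta> ^ m" using assms by simp
  then show ?thesis using assms by (simp add: pos_le_divide_eq mult.commute)
qed (use assms in simp)

definition max_len :: real where "max_len = max (len True) (len False)"
definition min_len :: real where "min_len = min (len True) (len False)"

lemma max_len: "0 < max_len" "max_len < 1"
  using len_pos len_less_1 by (auto simp: max_len_def less_max_iff_disj)

lemma max_len_powr_less_1: "0 < u \<Longrightarrow> max_len powr u < 1"
  using powr_less_mono2[of u max_len 1] max_len by simp

lemma min_len: "0 < min_len" "min_len < 1"
  using len_pos len_less_1 by (auto simp: min_len_def min_less_iff_disj)

lemma cyl_len_le_power: "cyl_len w \<le> max_len ^ length w"
proof (induction w)
  case (Cons i w)
  have "len i \<le> max_len" by (cases i) (auto simp: max_len_def)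
  then show ?case using mult_mono[OF _ Cons] len_pos[of i] max_len cyl_len_pos[of w] by simp
qed simp

lemma cyl_len_ge_power: "min_len ^ length w \<le> cyl_len w"
proof (induction w)
  case (Cons i w)
  have "min_len \<le> len i" by (cases i) (auto simp: min_len_def)
  then show ?case using mult_mono[OF _ Cons] len_pos[of i] min_len by simp
qed simp

text \<open>
  Call a word heavy if its weight is at least the \<open>s\<close>-th power of the length of its cylinder.
  The cost of a heavy cylinder of order \<open>n\<close> is at most \<open>\<theta>\<^sup>n\<close> times its weight, where \<open>\<theta> < 1\<close> comes from
  the surplus \<open>t - s\<close> in the exponent. The weights of words of length \<open>n\<close> add up to 1, which leaves the
  tail of a geometric series.
\<close>

lemma sum_diam_powr_le:
  assumes p: "0 < p" "p < 1" and st: "0 \<le> s" "s < t"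
    and F: "finite F" "\<And>w. w \<in> F \<Longrightarrow> m \<le> length w \<and> cyl_len w powr s \<le> word_weight p w"
  shows "(\<Sum>w\<in>F. diam_powr t (cyl w)) \<le> (max_len powr (t - s)) ^ m / (1 - max_len powr (t - s))"
proof -
  define \<theta> where "\<theta> = max_len powr (t - s)"
  have \<theta>: "0 < \<theta>" "\<theta> < 1"
    using max_len max_len_powr_less_1 st by (auto simp: \<theta>_def)
  have le: "diam_powr t (cyl w) \<le> \<theta> ^ length w * word_weight p w" if "w \<in> F" for w
  proof -
    have "diam_powr t (cyl w) \<le> cyl_len w powr t"
      using st by (simp add: diam_powr_def diameter_cyl)
    also have "\<dots> = cyl_len w powr (t - s) * cyl_len w powr s" by (simp flip: powr_add)
    also have "\<dots> \<le> (max_len ^ length w) powr (t - s) * word_weight p w"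
      using F(2)[OF that] cyl_len_le_power[of w] cyl_len_pos[of w] st
      by (intro mult_mono powr_mono2) auto
    also have "(max_len ^ length w) powr (t - s) = \<theta> ^ length w"
      unfolding \<theta>_def using max_len by (simp add: powr_realpow[symmetric] powr_powr mult.commute)
    finally show ?thesis .
  qed
  obtain M where M: "\<And>w. w \<in> F \<Longrightarrow> length w < M"
    using finite_nat_set_iff_bounded[of "length ` F"] F(1) by auto
  have "(\<Sum>w\<in>F. diam_powr t (cyl w)) \<le> (\<Sum>w\<in>F. \<theta> ^ length w * word_weight p w)"
    by (intro sum_mono le)
  also have "\<dots> = (\<Sum>n\<in>{m..<M}. \<Sum>w\<in>{w \<in> F. length w = n}. \<theta> ^ length w * word_weight p w)"
    by (rule sum.group[symmetric]) (use F M in auto)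
  also have "\<dots> \<le> (\<Sum>n\<in>{m..<M}. \<Sum>w | length w = n. \<theta> ^ length w * word_weight p w)"
    using \<theta> word_weight_pos[OF p]
    by (intro sum_mono sum_mono2 finite_words) (auto simp: less_imp_le)
  also have "\<dots> = (\<Sum>n\<in>{m..<M}. \<theta> ^ n * (\<Sum>w | length w = n. word_weight p w))"
    by (simp add: sum_distrib_left)
  also have "\<dots> \<le> \<theta> ^ m / (1 - \<theta>)"
    using sum_power_tail_le[of \<theta> m M] \<theta> by (simp add: sum_word_weight)
  finally show ?thesis by (simp add: \<theta>_def)
qed

text \<open>
  Every point of \<open>E\<close> lies in heavy cylinders of arbitrarily large order, so the heavy words of length
  at least \<open>m\<close> give a cover. Its cost tends to 0 as \<open>m\<close> grows.
\<close>

lemma hausdorff_measure_eq_0: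
  assumes p: "0 < p" "p < 1" and st: "0 \<le> s" "s < t"
    and E: "E \<subseteq> invariant_set dom T"
    and heavy: "\<And>x. x \<in> E \<Longrightarrow> \<forall>\<^sub>F n in sequentially.
      cyl_len (prefix_word (itinerary x) n) powr s \<le> word_weight p (prefix_word (itinerary x) n)"
  shows "hausdorff_measure t E = 0"
proof (rule hausdorff_measure_eq_0I)
  fix \<delta> \<epsilon> :: real assume pos: "0 < \<delta>" "0 < \<epsilon>"
  define \<theta> where "\<theta> = max_len powr (t - s)"
  have \<theta>: "0 < \<theta>" "\<theta> < 1"
    using max_len max_len_powr_less_1 st by (auto simp: \<theta>_def)
  have "\<forall>\<^sub>F m in sequentially. \<theta> ^ m < \<epsilon> * (1 - \<theta>)"
    using \<theta> pos by (intro order_tendstoD[OF LIMSEQ_power_zero]) auto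
  moreover have "\<forall>\<^sub>F m in sequentially. max_len ^ m < \<delta>"
    using max_len pos by (intro order_tendstoD[OF LIMSEQ_power_zero]) auto
  ultimately have "\<forall>\<^sub>F m in sequentially. \<theta> ^ m < \<epsilon> * (1 - \<theta>) \<and> max_len ^ m < \<delta>"
    by eventually_elim simp
  then obtain m where m: "\<theta> ^ m < \<epsilon> * (1 - \<theta>)" "max_len ^ m < \<delta>"
    by (auto simp: eventually_sequentially)
  define W where "W = {w. m \<le> length w \<and> cyl_len w powr s \<le> word_weight p w}"
  show "hausdorff_premeasure t \<delta> E \<le> ennreal \<epsilon>"
  proof (rule hausdorff_premeasure_le_countable_cover)
    show "E \<subseteq> (\<Union>w\<in>W. cyl w)"
    proof
      fix x assume x: "x \<in> E"
      from heavy[OF this] obtain N where N: "\<And>n. N \<le> n \<Longrightarrow>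
          cyl_len (prefix_word (itinerary x) n) powr s \<le> word_weight p (prefix_word (itinerary x) n)"
        by (auto simp: eventually_sequentially)
      have "prefix_word (itinerary x) (max m N) \<in> W" using N[of "max m N"] by (simp add: W_def)
      moreover have "x \<in> cyl (prefix_word (itinerary x) (max m N))"
        using x E by (auto simp: invariant_set_iff)
      ultimately show "x \<in> (\<Union>w\<in>W. cyl w)" by blast
    qed
    fix w assume "w \<in> W"
    have "cyl_len w \<le> max_len ^ length w" by (rule cyl_len_le_power)
    also have "\<dots> \<le> max_len ^ m"
      using \<open>w \<in> W\<close> max_len by (intro power_decreasing) (auto simp: W_def)
    finally show "bounded (cyl w) \<and> diameter (cyl w) \<le> \<delta>"
      using m(2) bounded_subset[OF bounded_closed_interval cyl_subset] by (simp add: diameter_cyl)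
  next
    fix F assume F: "finite F" "F \<subseteq> W"
    have "(\<Sum>w\<in>F. diam_powr t (cyl w)) \<le> \<theta> ^ m / (1 - \<theta>)"
      unfolding \<theta>_def by (rule sum_diam_powr_le[OF p st F(1)]) (use F(2) in \<open>auto simp: W_def\<close>)
    also have "\<dots> \<le> \<epsilon>" using m(1) \<theta> by (simp add: field_simps)
    finally show "(\<Sum>w\<in>F. diam_powr t (cyl w)) \<le> \<epsilon>" .
  qed (use pos in simp)
qed

section \<open>Lower bound: the mass distribution principle\<close>

definition point_of :: "(nat \<Rightarrow> bool) \<Rightarrow> real" where
  "point_of \<omega> = (SOME x. x \<in> invariant_set dom T \<and> itinerary x = \<omega>)"

lemma point_of: "point_of \<omega> \<in> invariant_set dom T" "itinerary (point_of \<omega>) = \<omega>"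
  using someI_ex[of "\<lambda>x. x \<in> invariant_set dom T \<and> itinerary x = \<omega>"] exists_point_with_itinerary[of \<omega>]
  unfolding point_of_def by blast+

lemma point_of_in_cyl: "point_of \<omega> \<in> cyl (prefix_word \<omega> n)"
  using point_of[of \<omega>] by (simp add: invariant_set_iff)

text \<open>
  Call a word light if its weight is at most the \<open>s\<close>-th power of the length of its cylinder.
  The order \<open>n\<close> is the least one for which the cylinder around the given point, scaled by the gap,
  is no longer than the diameter of \<open>U\<close>. By minimality the cylinder of order \<open>n - 1\<close> is so long that
  all coded points of \<open>U\<close> share the first \<open>n\<close> letters. The upper bound on the diameter of \<open>U\<close> ensures
  \<open>m \<le> n\<close>, so the weight of this cylinder is controlled.
\<close>

lemma small_set_in_light_cylinder:
  assumes p: "0 < p" "p < 1" and s: "0 < s"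
    and U: "bounded U" "0 < diameter U" "diameter U < gap * min_len ^ m"
    and \<omega>: "point_of \<omega> \<in> U"
    and light: "\<And>n. m \<le> n \<Longrightarrow> word_weight p (prefix_word \<omega> n) \<le> cyl_len (prefix_word \<omega> n) powr s"
  obtains n where "\<And>\<eta>. point_of \<eta> \<in> U \<Longrightarrow> prefix_word \<eta> n = prefix_word \<omega> n"
    and "gap powr s * word_weight p (prefix_word \<omega> n) \<le> diameter U powr s"
proof -
  define P where "P = (\<lambda>n. gap * cyl_len (prefix_word \<omega> n) \<le> diameter U)"
  have "\<forall>\<^sub>F n in sequentially. max_len ^ n < diameter U / gap"
    using max_len U(2) gap_pos by (intro order_tendstoD[OF LIMSEQ_power_zero]) auto
  then obtain n0 where "max_len ^ n0 < diameter U / gap" by (auto simp: eventually_sequentially)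
  moreover have "cyl_len (prefix_word \<omega> n0) \<le> max_len ^ n0" using cyl_len_le_power[of "prefix_word \<omega> n0"] by simp
  ultimately have "cyl_len (prefix_word \<omega> n0) \<le> diameter U / gap" by linarith
  then have "P n0" using gap_pos by (simp add: P_def field_simps)
  define n where "n = (LEAST n. P n)"
  have n: "P n" unfolding n_def using \<open>P n0\<close> by (rule LeastI)
  have not_P: "\<not> P k" if "k < n" for k using that unfolding n_def by (rule not_less_Least)
  have "m \<le> n"
  proof (rule ccontr)
    assume "\<not> m \<le> n"
    then have "min_len ^ m \<le> min_len ^ n" using min_len by (intro power_decreasing) auto
    also have "\<dots> \<le> cyl_len (prefix_word \<omega> n)" using cyl_len_ge_power[of "prefix_word \<omega> n"] by simp
    finally have "gap * min_len ^ m \<le> gap * cyl_len (prefix_word \<omega> n)" using gap_pos by simp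
    then show False using n U(3) by (simp add: P_def)
  qed
  have "prefix_word \<eta> n = prefix_word \<omega> n" if "point_of \<eta> \<in> U" for \<eta>
  proof (cases n)
    case 0
    then show ?thesis by (simp add: prefix_word_def)
  next
    case (Suc k)
    have "\<bar>point_of \<omega> - point_of \<eta>\<bar> \<le> diameter U"
      using diameter_bounded_bound[OF U(1) \<omega> that] by (simp add: dist_real_def)
    also have "\<dots> < gap * cyl_len (prefix_word \<omega> k)" using not_P[of k] Suc by (simp add: P_def)
    also have "prefix_word \<omega> k = butlast (prefix_word \<omega> n)" by (simp add: prefix_word_def Suc)
    finally show ?thesis
      by (intro cyl_close_imp_eq[OF _ point_of_in_cyl point_of_in_cyl]) simp_all
  qed
  moreover have "gap powr s * word_weight p (prefix_word \<omega> n) \<le> diameter U powr s"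
  proof -
    have "gap powr s * word_weight p (prefix_word \<omega> n) \<le> gap powr s * cyl_len (prefix_word \<omega> n) powr s"
      using light[OF \<open>m \<le> n\<close>] by (intro mult_left_mono) auto
    also have "\<dots> = (gap * cyl_len (prefix_word \<omega> n)) powr s"
      using gap_pos cyl_len_pos[of "prefix_word \<omega> n"] by (simp add: powr_mult)
    also have "\<dots> \<le> diameter U powr s"
      using n gap_pos cyl_len_pos[of "prefix_word \<omega> n"] s by (intro powr_mono2) (auto simp: P_def)
    finally show ?thesis .
  qed
  ultimately show ?thesis using that by blast
qed

text \<open>
  The core of the mass distribution principle. The set \<open>U\<close> is arbitrary and its preimage under the
  coding need not be measurable, so the relevant part of it is enclosed in a cylinder. There are
  two degenerate cases: for \<open>s = 0\<close> a nonempty set costs 1, as much as the whole space weighs, and a set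
  of diameter 0 meets the coded points in at most one point, which has probability 0.
\<close>

lemma exists_covering_event:
  assumes p: "0 < p" "p < 1" and s: "0 \<le> s"
    and U: "bounded U" "diameter U < gap * min_len ^ m"
  defines "G \<equiv> {\<omega>. \<forall>n\<ge>m. word_weight p (prefix_word \<omega> n) \<le> cyl_len (prefix_word \<omega> n) powr s}"
  shows "\<exists>K \<in> sets (bernoulli_process p). {\<omega> \<in> G. point_of \<omega> \<in> U} \<subseteq> K \<and>
    ennreal (gap powr s) * emeasure (bernoulli_process p) K \<le> ennreal (diam_powr s U)"
proof -
  interpret prob_space "bernoulli_process p" by (rule prob_space_bernoulli_process)
  consider "{\<omega> \<in> G. point_of \<omega> \<in> U} = {}" | \<omega> where "\<omega> \<in> G" "point_of \<omega> \<in> U" by blast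
  then show ?thesis
  proof cases
    case 1
    then show ?thesis by (intro bexI[of _ "{}"]) auto
  next
    case (2 \<omega>)
    then have ne: "U \<noteq> {}" by auto
    have light: "word_weight p (prefix_word \<omega> n) \<le> cyl_len (prefix_word \<omega> n) powr s" if "m \<le> n" for n
      using 2 that by (simp add: G_def)
    have d: "0 \<le> diameter U" using U(1) by (rule diameter_ge_0)
    consider "s = 0" | "0 < s" "diameter U = 0" | "0 < s" "0 < diameter U" using s d by linarith
    then show ?thesis
    proof cases
      case 1
      then show ?thesis using ne emeasure_space_1 gap_pos sets.top[of "bernoulli_process p"]
        by (intro bexI[of _ "space (bernoulli_process p)"]) (auto simp: diam_powr_def)
    next
      case 2
      let ?K = "{\<eta> \<in> space (bernoulli_process p). \<forall>n. prefix_word \<eta> n = prefix_word \<omega> n}"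
      have K: "?K \<in> sets (bernoulli_process p)" by measurable
      have "{\<omega> \<in> G. point_of \<omega> \<in> U} \<subseteq> ?K"
      proof safe
        fix \<eta> n assume "point_of \<eta> \<in> U"
        then have "point_of \<eta> = point_of \<omega>"
          using diameter_bounded_bound[OF U(1) \<open>point_of \<omega> \<in> U\<close>] 2 by fastforce
        then show "prefix_word \<eta> n = prefix_word \<omega> n" by (metis point_of(2))
      qed simp
      moreover have "emeasure (bernoulli_process p) ?K = 0"
      proof -
        have "emeasure (bernoulli_process p) ?K \<le> ennreal ((max_len powr s) ^ n)" if "m \<le> n" for n
        proof -
          have "emeasure (bernoulli_process p) ?K \<le>
              emeasure (bernoulli_process p) {\<eta> \<in> space (bernoulli_process p). prefix_word \<eta> n = prefix_word \<omega> n}"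
          proof (rule emeasure_mono)
            show "{\<eta> \<in> space (bernoulli_process p). prefix_word \<eta> n = prefix_word \<omega> n} \<in> events"
              by measurable
          qed blast
          also have "\<dots> = ennreal (word_weight p (prefix_word \<omega> n))"
            using emeasure_prefix[of p n \<omega>] p by simp
          also have "word_weight p (prefix_word \<omega> n) \<le> (max_len ^ n) powr s"
            using light[OF that] cyl_len_le_power[of "prefix_word \<omega> n"] cyl_len_pos[of "prefix_word \<omega> n"] s
            by (elim order_trans) (auto intro!: powr_mono2)
          also have "(max_len ^ n) powr s = (max_len powr s) ^ n"
            using max_len by (simp add: powr_realpow[symmetric] powr_powr mult.commute)
          finally show ?thesis by (simp add: ennreal_leI)
        qed
        moreover have "(\<lambda>n. ennreal ((max_len powr s) ^ n)) \<longlonglongrightarrow> ennreal 0"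
          using max_len 2 by (intro tendsto_ennrealI LIMSEQ_power_zero) (simp add: max_len_powr_less_1)
        ultimately have "emeasure (bernoulli_process p) ?K \<le> ennreal 0"
          by (intro LIMSEQ_le_const) auto
        then show ?thesis by simp
      qed
      ultimately show ?thesis using K by (intro bexI[of _ ?K]) auto
    next
      case 3
      obtain n where n: "\<And>\<eta>. point_of \<eta> \<in> U \<Longrightarrow> prefix_word \<eta> n = prefix_word \<omega> n"
        and le: "gap powr s * word_weight p (prefix_word \<omega> n) \<le> diameter U powr s"
        using small_set_in_light_cylinder[OF p 3(1) U(1) 3(2) U(2) 2(2) light] by blast
      let ?K = "{\<eta> \<in> space (bernoulli_process p). prefix_word \<eta> n = prefix_word \<omega> n}"
      have K: "?K \<in> sets (bernoulli_process p)" by measurable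
      have "ennreal (gap powr s) * emeasure (bernoulli_process p) ?K =
          ennreal (gap powr s * word_weight p (prefix_word \<omega> n))"
        using emeasure_prefix[of p n \<omega>] p word_weight_pos[OF p]
        by (simp add: ennreal_mult less_imp_le)
      also have "\<dots> \<le> ennreal (diam_powr s U)"
        using le ne 3 by (simp add: diam_powr_def ennreal_leI)
      finally show ?thesis using K n by (intro bexI[of _ ?K]) auto
    qed
  qed
qed

text \<open>
  Almost every sequence has only light cylinders from some order \<open>m\<close> on, so for some \<open>m\<close> the set \<open>G m\<close> of
  the sequences with light cylinders from order \<open>m\<close> on has positive probability. Each cover of \<open>E\<close> by
  sufficiently small sets yields a cover of almost all of \<open>G m\<close> by events, and its cost is bounded
  below by the probability of \<open>G m\<close> up to a constant factor.
\<close>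

lemma hausdorff_measure_pos:
  assumes p: "0 < p" "p < 1" and s: "0 \<le> s"
    and E: "AE \<omega> in bernoulli_process p. point_of \<omega> \<in> E"
    and light: "AE \<omega> in bernoulli_process p. \<forall>\<^sub>F n in sequentially.
      word_weight p (prefix_word \<omega> n) \<le> cyl_len (prefix_word \<omega> n) powr s"
  shows "0 < hausdorff_measure s E"
proof -
  interpret prob_space "bernoulli_process p" by (rule prob_space_bernoulli_process)
  define G where "G = (\<lambda>m. {\<omega>. \<forall>n\<ge>m. word_weight p (prefix_word \<omega> n) \<le> cyl_len (prefix_word \<omega> n) powr s})"
  have G_sets: "G m \<in> events" for m
  proof -
    have "{\<omega> \<in> space (bernoulli_process p). \<forall>n\<ge>m. word_weight p (prefix_word \<omega> n) \<le> cyl_len (prefix_word \<omega> n) powr s} \<in> events"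
      by measurable
    then show ?thesis by (simp add: G_def)
  qed
  have "\<exists>m. emeasure (bernoulli_process p) (G m) \<noteq> 0"
  proof (rule ccontr)
    assume "\<not> ?thesis"
    then have "G m \<in> null_sets (bernoulli_process p)" for m using G_sets by (auto intro: null_setsI)
    then have "AE \<omega> in bernoulli_process p. \<forall>m. \<omega> \<notin> G m"
      by (simp add: AE_all_countable AE_not_in)
    with light have "AE \<omega> in bernoulli_process p. False"
      by eventually_elim (auto simp: eventually_sequentially G_def)
    then show False by simp
  qed
  then obtain m where m: "0 < emeasure (bernoulli_process p) (G m)" by (auto simp: zero_less_iff_neq_zero)
  \<comment> \<open>Small enough that a set of diameter at most \<open>\<delta>\<close> meets only one cylinder of order \<open>m\<close>.\<close>
  define \<delta> where "\<delta> = gap * min_len ^ m / 2"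
  have \<delta>: "0 < \<delta>" "\<delta> < gap * min_len ^ m" using gap_pos min_len by (auto simp: \<delta>_def)
  define \<kappa> where "\<kappa> = ennreal (gap powr s) * emeasure (bernoulli_process p) (G m)"
  have "\<kappa> \<le> hausdorff_premeasure s \<delta> E"
    unfolding hausdorff_premeasure_def
  proof (rule Inf_greatest, clarify)
    fix U :: "nat \<Rightarrow> real set"
    assume cover: "E \<subseteq> (\<Union>i. U i)" and small: "\<forall>i. bounded (U i) \<and> diameter (U i) \<le> \<delta>"
    have "\<exists>K \<in> events. {\<omega> \<in> G m. point_of \<omega> \<in> U i} \<subseteq> K \<and>
        ennreal (gap powr s) * emeasure (bernoulli_process p) K \<le> ennreal (diam_powr s (U i))" for i
      unfolding G_def using small \<delta>(2) by (intro exists_covering_event[OF p s]) (auto intro: le_less_trans)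
    then have "\<exists>K. \<forall>i. K i \<in> events \<and> {\<omega> \<in> G m. point_of \<omega> \<in> U i} \<subseteq> K i \<and>
        ennreal (gap powr s) * emeasure (bernoulli_process p) (K i) \<le> ennreal (diam_powr s (U i))"
      by (intro choice allI) blast
    then obtain K where K: "\<And>i. K i \<in> events" "\<And>i. {\<omega> \<in> G m. point_of \<omega> \<in> U i} \<subseteq> K i"
      "\<And>i. ennreal (gap powr s) * emeasure (bernoulli_process p) (K i) \<le> ennreal (diam_powr s (U i))"
      by blast
    have "emeasure (bernoulli_process p) (G m) \<le> emeasure (bernoulli_process p) (\<Union>i. K i)"
    proof (rule emeasure_mono_AE)
      show "AE \<omega> in bernoulli_process p. \<omega> \<in> G m \<longrightarrow> \<omega> \<in> (\<Union>i. K i)"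
        using E by eventually_elim (use cover K(2) in blast)
    qed (use K(1) in auto)
    also have "\<dots> \<le> (\<Sum>i. emeasure (bernoulli_process p) (K i))"
      using K(1) by (intro emeasure_subadditive_countably) auto
    finally have "\<kappa> \<le> ennreal (gap powr s) * (\<Sum>i. emeasure (bernoulli_process p) (K i))"
      unfolding \<kappa>_def by (rule mult_left_mono) simp
    also have "\<dots> = (\<Sum>i. ennreal (gap powr s) * emeasure (bernoulli_process p) (K i))"
      by simp
    also have "\<dots> \<le> (\<Sum>i. ennreal (diam_powr s (U i)))"
      by (intro suminf_le K(3) summableI)
    finally show "\<kappa> \<le> (\<Sum>i. ennreal (diam_powr s (U i)))" .
  qed
  also have "\<dots> \<le> hausdorff_measure s E"
    unfolding hausdorff_measure_def using \<delta>(1) by (intro SUP_upper) auto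
  finally have "\<kappa> \<le> hausdorff_measure s E" .
  moreover have "0 < \<kappa>" using m gap_pos by (simp add: \<kappa>_def ennreal_zero_less_mult_iff)
  ultimately show ?thesis by simp
qed

section \<open>The Lyapunov spectrum and its inflections\<close>

text \<open>
  Both logarithms are sums over the letters, so the averages converge along a sequence with
  frequency \<open>p\<close>: to \<open>- H(p)\<close> for the weight and to minus the Lyapunov exponent for the length. The sign
  of the limit decides whether the prefixes are eventually light or eventually heavy.
\<close>

lemma weight_length_ratio_tendsto:
  assumes p: "0 < p" "p < 1" and freq: "has_frequency \<omega> p"
  shows "(\<lambda>n. (ln (word_weight p (prefix_word \<omega> n)) - s * ln (cyl_len (prefix_word \<omega> n))) / real n)
    \<longlonglongrightarrow> s * (p * rate True + (1 - p) * rate False) - bernoulli_entropy p"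
proof -
  define F where "F = (\<lambda>i. ln (if i then p else 1 - p) + s * rate i)"
  have "(\<lambda>n. (\<Sum>k<n. F (\<omega> k)) / real n) \<longlonglongrightarrow> p * F True + (1 - p) * F False"
    by (rule average_tendsto[OF freq])
  moreover have "(\<Sum>k<n. F (\<omega> k)) = ln (word_weight p (prefix_word \<omega> n)) - s * ln (cyl_len (prefix_word \<omega> n))" for n
    by (simp add: F_def ln_word_weight_prefix[OF p] ln_cyl_len_prefix rate_def sum_subtractf sum_distrib_left)
  moreover have "p * F True + (1 - p) * F False
      = s * (p * rate True + (1 - p) * rate False) - bernoulli_entropy p"
    by (simp add: F_def bernoulli_entropy_def algebra_simps)
  ultimately show ?thesis by simp
qed

lemma eventually_light:
  assumes p: "0 < p" "p < 1" and freq: "has_frequency \<omega> p"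
    and s: "s * (p * rate True + (1 - p) * rate False) < bernoulli_entropy p"
  shows "\<forall>\<^sub>F n in sequentially. word_weight p (prefix_word \<omega> n) \<le> cyl_len (prefix_word \<omega> n) powr s"
proof -
  have "\<forall>\<^sub>F n in sequentially.
      (ln (word_weight p (prefix_word \<omega> n)) - s * ln (cyl_len (prefix_word \<omega> n))) / real n < 0"
    using s by (intro order_tendstoD(2)[OF weight_length_ratio_tendsto[OF p freq]]) simp
  then show ?thesis
  proof eventually_elim
    case (elim n)
    then have "ln (word_weight p (prefix_word \<omega> n)) < ln (cyl_len (prefix_word \<omega> n) powr s)"
      using cyl_len_pos[of "prefix_word \<omega> n"] by (simp add: divide_less_0_iff ln_powr)
    then show ?case
      using word_weight_pos[OF p, of "prefix_word \<omega> n"] cyl_len_pos[of "prefix_word \<omega> n"]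
      by (subst (asm) ln_less_cancel_iff) auto
  qed
qed

lemma eventually_heavy:
  assumes p: "0 < p" "p < 1" and freq: "has_frequency \<omega> p"
    and s: "bernoulli_entropy p < s * (p * rate True + (1 - p) * rate False)"
  shows "\<forall>\<^sub>F n in sequentially. cyl_len (prefix_word \<omega> n) powr s \<le> word_weight p (prefix_word \<omega> n)"
proof -
  have "\<forall>\<^sub>F n in sequentially.
      (ln (word_weight p (prefix_word \<omega> n)) - s * ln (cyl_len (prefix_word \<omega> n))) / real n > 0"
    using s by (intro order_tendstoD(1)[OF weight_length_ratio_tendsto[OF p freq]]) simp
  then show ?thesis
  proof eventually_elim
    case (elim n)
    then have "ln (cyl_len (prefix_word \<omega> n) powr s) < ln (word_weight p (prefix_word \<omega> n))"
      using cyl_len_pos[of "prefix_word \<omega> n"] by (simp add: zero_less_divide_iff ln_powr)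
    then show ?case
      using word_weight_pos[OF p, of "prefix_word \<omega> n"] cyl_len_pos[of "prefix_word \<omega> n"]
      by (subst (asm) ln_less_cancel_iff) auto
  qed
qed

text \<open>
  If the two rates differ, prescribing the Lyapunov exponent amounts to prescribing the frequency of
  the first branch. Hence every point of the level set has a heavy itinerary above the critical
  exponent, and almost every Bernoulli sequence has a light one below it and codes a point of the
  level set.
\<close>

lemma hausdorff_dim_level_set:
  assumes ne: "rate True \<noteq> rate False" and p: "0 < p" "p < 1"
    and \<alpha>: "\<alpha> = p * rate True + (1 - p) * rate False"
  shows "hausdorff_dim {x \<in> invariant_set dom T. has_lyapunov_exponent dom T x \<alpha>} =
    ennreal (bernoulli_entropy p / \<alpha>)"
proof (rule antisym)
  let ?E = "{x \<in> invariant_set dom T. has_lyapunov_exponent dom T x \<alpha>}"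
  have \<alpha>_pos: "0 < \<alpha>" using p rate_pos by (simp add: \<alpha> add_pos_pos)
  have p_eq: "(\<alpha> - rate False) / (rate True - rate False) = p"
    using ne by (simp add: \<alpha> field_simps)
  have nonneg: "0 \<le> bernoulli_entropy p / \<alpha>" using bernoulli_entropy_nonneg[OF p] \<alpha>_pos by simp
  show "hausdorff_dim ?E \<le> ennreal (bernoulli_entropy p / \<alpha>)"
  proof (rule ennreal_le_epsilon)
    fix e :: real assume "0 < e"
    \<comment> \<open>An exponent strictly between the critical one and \<open>?t\<close>, at which itineraries are heavy.\<close>
    let ?s = "bernoulli_entropy p / \<alpha> + e / 2" and ?t = "bernoulli_entropy p / \<alpha> + e"
    have "hausdorff_measure ?t ?E = 0"
    proof (rule hausdorff_measure_eq_0[OF p])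
      show "0 \<le> ?s" "?s < ?t" using nonneg \<open>0 < e\<close> by auto
      fix x assume x: "x \<in> ?E"
      then have "(\<lambda>n. (\<Sum>k<n. rate (itinerary x k)) / real n) \<longlonglongrightarrow> \<alpha>"
        using has_lyapunov_exponent_iff by blast
      from has_frequency_of_average[of rate, OF this ne] have freq: "has_frequency (itinerary x) p"
        by (simp add: p_eq)
      have "bernoulli_entropy p < ?s * \<alpha>"
        using \<open>0 < e\<close> \<alpha>_pos by (simp add: distrib_right)
      then show "\<forall>\<^sub>F n in sequentially.
          cyl_len (prefix_word (itinerary x) n) powr ?s \<le> word_weight p (prefix_word (itinerary x) n)"
        by (rule eventually_heavy[OF p freq, folded \<alpha>])
    qed auto
    then have "hausdorff_dim ?E \<le> ennreal ?t"
      unfolding hausdorff_dim_def using nonneg \<open>0 < e\<close> by (intro INF_lower) auto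
    then show "hausdorff_dim ?E \<le> ennreal (bernoulli_entropy p / \<alpha>) + ennreal e"
      using nonneg \<open>0 < e\<close> by simp
  qed
  show "ennreal (bernoulli_entropy p / \<alpha>) \<le> hausdorff_dim ?E"
    unfolding hausdorff_dim_def
  proof (rule INF_greatest, clarify, rule ennreal_leI, rule ccontr)
    fix s assume s: "0 \<le> s" "hausdorff_measure s ?E = 0" "\<not> bernoulli_entropy p / \<alpha> \<le> s"
    then have s_less: "s * \<alpha> < bernoulli_entropy p" using \<alpha>_pos by (simp add: field_simps not_le)
    have freq: "AE \<omega> in bernoulli_process p. has_frequency \<omega> p" using p by (intro AE_has_frequency) auto
    have "0 < hausdorff_measure s ?E"
    proof (rule hausdorff_measure_pos[OF p s(1)])
      show "AE \<omega> in bernoulli_process p. point_of \<omega> \<in> ?E"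
        using freq
      proof eventually_elim
        case (elim \<omega>)
        then show ?case
          using average_tendsto[OF elim, of rate] point_of[of \<omega>]
          by (simp add: has_lyapunov_exponent_iff \<alpha>)
      qed
      show "AE \<omega> in bernoulli_process p. \<forall>\<^sub>F n in sequentially.
          word_weight p (prefix_word \<omega> n) \<le> cyl_len (prefix_word \<omega> n) powr s"
        using freq by eventually_elim (use s_less in \<open>auto intro!: eventually_light[OF p] simp: \<alpha>\<close>)
    qed
    with s(2) show False by simp
  qed
qed

lemma lyapunov_spectrum_eq:
  assumes "\<alpha> \<in> {min (rate True) (rate False)<..<max (rate True) (rate False)}"
  shows "lyapunov_spectrum dom T \<alpha> =
    bernoulli_entropy ((\<alpha> - rate False) / (rate True - rate False)) / \<alpha>"
proof -
  define p where "p = (\<alpha> - rate False) / (rate True - rate False)"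
  have p: "0 < p" "p < 1" using affine_mem_unit_interval[OF assms] by (auto simp: p_def)
  have ne: "rate True \<noteq> rate False" using assms by auto
  then have "p * (rate True - rate False) = \<alpha> - rate False" by (simp add: p_def)
  then have \<alpha>: "\<alpha> = p * rate True + (1 - p) * rate False" by (simp add: algebra_simps)
  have "0 < \<alpha>" using assms rate_pos by (auto simp: min_def split: if_splits intro: less_trans)
  then show ?thesis
    unfolding lyapunov_spectrum_def hausdorff_dim_level_set[OF ne p \<alpha>] p_def[symmetric]
    using bernoulli_entropy_nonneg[OF p] by simp
qed

lemma lyapunov_values_subset:
  "lyapunov_values dom T \<subseteq> {min (rate True) (rate False)..max (rate True) (rate False)}"
proof
  fix \<alpha> assume "\<alpha> \<in> lyapunov_values dom T"
  then obtain x where x: "x \<in> invariant_set dom T" "has_lyapunov_exponent dom T x \<alpha>"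
    by (auto simp: lyapunov_values_def)
  then have lim: "(\<lambda>n. (\<Sum>k<n. rate (itinerary x k)) / real n) \<longlonglongrightarrow> \<alpha>"
    by (simp add: has_lyapunov_exponent_iff)
  have rate: "min (rate True) (rate False) \<le> rate i" "rate i \<le> max (rate True) (rate False)" for i
    by (cases i; simp)+
  have lo: "min (rate True) (rate False) \<le> (\<Sum>k<n. rate (itinerary x k)) / real n" if "1 \<le> n" for n
    using sum_bounded_below[of "{..<n}" "min (rate True) (rate False)" "\<lambda>k. rate (itinerary x k)"] rate that
    by (simp add: field_simps)
  have hi: "(\<Sum>k<n. rate (itinerary x k)) / real n \<le> max (rate True) (rate False)" if "1 \<le> n" for n
    using sum_bounded_above[of "{..<n}" "\<lambda>k. rate (itinerary x k)" "max (rate True) (rate False)"] rate that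
    by (simp add: field_simps)
  show "\<alpha> \<in> {min (rate True) (rate False)..max (rate True) (rate False)}"
    using LIMSEQ_le_const[OF lim] LIMSEQ_le_const2[OF lim] lo hi unfolding atLeastAtMost_iff by blast
qed

text \<open>
  The infimum and the supremum of the empty set of reals are unspecified, so bounds on them need
  some exponent. A point that never leaves the first branch provides one.
\<close>

lemma lyapunov_values_nonempty: "lyapunov_values dom T \<noteq> {}"
proof -
  have "has_frequency (\<lambda>_. True) 1"
    unfolding has_frequency_def
    by (rule Lim_transform_eventually[OF tendsto_const])
      (use eventually_gt_at_top[of 0] in \<open>auto elim!: eventually_mono\<close>)
  from average_tendsto[OF this, of rate] have "has_lyapunov_exponent dom T (point_of (\<lambda>_. True)) (rate True)"
    using point_of[of "\<lambda>_. True"] by (simp add: has_lyapunov_exponent_iff)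
  then show ?thesis using point_of(1) by (auto simp: lyapunov_values_def)
qed

text \<open>
  Inflection points therefore lie where the entropy formula for the spectrum holds. If the two
  rates agree, both intervals are empty.
\<close>

lemma lyapunov_interval_subset:
  "{lyapunov_min dom T<..<lyapunov_max dom T}
    \<subseteq> {min (rate True) (rate False)<..<max (rate True) (rate False)}"
proof -
  have "min (rate True) (rate False) \<le> lyapunov_min dom T"
    unfolding lyapunov_min_def using lyapunov_values_subset lyapunov_values_nonempty
    by (intro cInf_greatest) auto
  moreover have "lyapunov_max dom T \<le> max (rate True) (rate False)"
    unfolding lyapunov_max_def using lyapunov_values_subset lyapunov_values_nonempty
    by (intro cSup_least) auto
  ultimately show ?thesis by auto
qed

lemma card_inflection_points:
  "finite (inflection_points dom T) \<and> card (inflection_points dom T) \<le> 2"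
proof -
  let ?S = "{\<alpha> \<in> {min (rate True) (rate False)<..<max (rate True) (rate False)}.
    deriv (deriv (lyapunov_spectrum dom T)) \<alpha> = 0}"
  have S: "finite ?S \<and> card ?S \<le> 2"
    by (rule card_inflections_entropy_quotient[OF rate_pos rate_pos lyapunov_spectrum_eq])
  moreover have "inflection_points dom T \<subseteq> ?S"
    unfolding inflection_points_def using lyapunov_interval_subset by blast
  ultimately show ?thesis by (meson card_mono finite_subset order_trans)
qed

end

theorem theorem1p3:
  fixes X :: "nat \<Rightarrow> real set" and T :: "real \<Rightarrow> real"
  assumes "piecewise_linear_map 2 X T"
  shows "finite (inflection_points (\<Union>i\<in>{1..2}. X i) T) \<and>
         card (inflection_points (\<Union>i\<in>{1..2}. X i) T) \<le> 2"
proof -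
  have ivl: "{1..2::nat} = {1, 2}" by auto
  define ix :: "bool \<Rightarrow> nat" where "ix = (\<lambda>i. if i then 1 else 2)"
  have "\<forall>i. \<exists>a b c d. a < b \<and> X (ix i) = {a..b} \<and> X (ix i) \<subseteq> {0..1} \<and>
      (\<forall>x\<in>X (ix i). T x = c * x + d) \<and> T ` X (ix i) = {0..1}"
  proof
    fix i :: bool
    have "ix i \<in> {1..2}" by (simp add: ix_def)
    then show "\<exists>a b c d. a < b \<and> X (ix i) = {a..b} \<and> X (ix i) \<subseteq> {0..1} \<and>
        (\<forall>x\<in>X (ix i). T x = c * x + d) \<and> T ` X (ix i) = {0..1}"
      using assms unfolding piecewise_linear_map_def homeomorphism_def by meson
  qed
  then obtain A B c d where AB: "\<And>i. A i < B i" "\<And>i. X (ix i) = {A i..B i}"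
    "\<And>i. X (ix i) \<subseteq> {0..1}" "\<And>i x. x \<in> X (ix i) \<Longrightarrow> T x = c i * x + d i"
    "\<And>i. T ` X (ix i) = {0..1}"
    by metis
  have "disjoint_family_on X {1..2}" using assms by (simp add: piecewise_linear_map_def)
  then have "X (ix True) \<inter> X (ix False) = {}" by (auto simp: disjoint_family_on_def ix_def)
  then interpret two_branch_map A B c d T
  proof unfold_locales
    show "0 \<le> A i" "B i \<le> 1" for i using AB(1,3)[of i] by (auto simp: AB(2))
    show "T x = c i * x + d i" if "x \<in> {A i..B i}" for x i using AB(4)[of x i] that by (simp add: AB(2))
    show "T ` {A i..B i} = {0..1}" for i using AB(5)[of i] by (simp add: AB(2))
  qed (simp_all add: AB(1,2))
  have "(\<Union>i\<in>{1..2}. X i) = dom"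
    unfolding ivl using AB(2)[of True] AB(2)[of False] by (simp add: ix_def)
  then show ?thesis using card_inflection_points by simp
qed

end
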